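(* Let $x\in\mathcal{M}$ and suppose $\beta\ge\beta_x$. Then any local minimizer of (OCP) in $\bar\Omega_x$ is a local minimizer of (CDF). Moreover, any local minimizer of (CDF) in $\bar\Omega_x$ is a local minimizer of (OCP).
   Context: Setting. $\|\cdot\|$ is the $\ell_2$-norm of vectors or the induced operator norm. Let $f:\mathbb{R}^n\to\mathbb{R}$, $c:\mathbb{R}^n\to\mathbb{R}^p$ be differentiable, $\mathcal{M}=\{x\in\mathbb{R}^n: c(x)=0\}$, and consider the problem (OCP): minimize $f(x)$ subject to $c(x)=0$ (local minimizers of (OCP) are local minimizers of $f$ restricted to $\mathcal{M}$). $J_c(x)\in\mathbb{R}^{n\times p}$ is the transposed Jacobian of $c$ (entry $(i,j)$ is $\partial c_j/\partial x_i$). Assumed: $\nabla f$ and $J_c$ are locally Lipschitz continuous on $\mathbb{R}^n$, and $J_c(x)$ has full column rank for every $x\in\mathcal{M}$. Let $\mathcal{A}:\mathbb{R}^n\to\mathbb{R}^n$ be differentiable with transposed Jacobian $J_{\mathcal{A}}(x)\in\mathbb{R}^{n\times n}$ (entry $(i,j)$ is $\partial\mathcal{A}_j/\partial x_i$), such that $J_{\mathcal{A}}$ is locally Lipschitz continuous on $\mathbb{R}^n$, $\mathcal{A}(x)=x$ for $x\in\mathcal{M}$, and $J_{\mathcal{A}}(x)J_c(x)=0$ for $x\in\mathcal{M}$. Put $g(x)=f(\mathcal{A}(x))$ and, for a penalty parameter $\beta>0$, $h(x)=f(\mathcal{A}(x))+\frac{\beta}{2}\|c(x)\|^2$; (CDF)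 is the problem of minimizing $h$ over $\mathbb{R}^n$. $\nabla f(\mathcal{A}(y))$ denotes $\nabla f$ evaluated at $\mathcal{A}(y)$. Constants. For $x\in\mathcal{M}$, $\rho_x$ is the largest $\rho\in(0,1]$ with $\inf\{\sigma_{\min}(J_c(y)):\|y-x\|\le\rho\}\ge\frac12\sigma_{\min}(J_c(x))$ ($\sigma_{\min}$ = smallest singular value); $\Theta_x=\{y:\|y-x\|\le\rho_x\}$; $\sigma_{x,c}=\sigma_{\min}(J_c(x))$; $M_{x,f}=\sup_{y\in\Theta_x}\|\nabla f(\mathcal{A}(y))\|$; $M_{x,c}=\sup_{y\in\Theta_x}\|J_c(y)\|$; $M_{x,A}=\sup_{y\in\Theta_x}\|J_{\mathcal{A}}(y)\|$; $L_{x,g},L_{x,c},L_{x,A},L_{x,b}$ are the least Lipschitz constants on $\Theta_x$ (suprema of difference quotients over $y\ne z$ in $\Theta_x$) of $\nabla g$, $J_c$, $J_{\mathcal{A}}$, and $y\mapsto J_{\mathcal{A}}(y)J_c(\mathcal{A}(y))$ respectively. Put $$\varepsilon_x=\min\Big\{\frac{\rho_x}{2},\ \frac{\sigma_{x,c}}{32L_{x,c}(M_{x,A}+1)},\ \frac{\sigma_{x,c}^2}{8L_{x,b}M_{x,c}}\Big\}$$ (a fraction with zero denominator is read as $+\infty$), $\bar\Omega_x=\Big\{y\in\mathbb{R}^n:\|y-x\|\le\dfrac{\sigma_{x,c}\,\varepsilon_x}{4M_{x,c}(M_{x,A}+1)+\sigma_{x,c}}\Big\}$, and $$\beta_x=\max\Big\{\frac{128L_{x,g}(M_{x,A}+1)^2}{\sigma_{x,c}^2},\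 \frac{64M_{x,f}(M_{x,A}+1)L_{x,b}}{\sigma_{x,c}^3},\ \frac{16M_{x,f}L_{x,A}(2M_{x,A}+1)}{\sigma_{x,c}^2}\Big\}.$$ *)

theory Defs
  imports "HOL-Analysis.Analysis"
begin

definition grad :: "('a::real_inner \<Rightarrow> real) \<Rightarrow> 'a \<Rightarrow> 'a"
  where "grad f x = (THE D. GDERIV f x :> D)"

text \<open>Entry \<open>(i, j)\<close> of \<open>tjac F x\<close> is the partial derivative of the \<open>j\<close>-th component of \<open>F\<close> in
  direction \<open>i\<close>.\<close>

definition tjac :: "(real^'n \<Rightarrow> real^'m) \<Rightarrow> real^'n \<Rightarrow> real^'m^'n"
  where "tjac F x = transpose (jacobian F (at x))"

text \<open>The type-class norm on matrices is the Frobenius norm. For the norm induced by the Euclidean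
  norms, matrices are turned into bounded linear operators, whose type-class norm is the operator
  norm.\<close>

definition matop :: "real^'m^'n \<Rightarrow> ((real^'m) \<Rightarrow>\<^sub>L (real^'n))"
  where "matop B = Blinfun (\<lambda>v. B *v v)"

text \<open>Singular values as square roots of the eigenvalues of the Gram matrix of the columns. This is
  the usual set of singular values for matrices with at least as many rows as columns.\<close>

definition singular_values :: "real^'m^'n \<Rightarrow> real set"
  where "singular_values B =
    {s. 0 \<le> s \<and> (\<exists>v. v \<noteq> 0 \<and> (transpose B ** B) *v v = s\<^sup>2 *\<^sub>R v)}"

definition sigma_min :: "real^'m^'n \<Rightarrow> real"
  where "sigma_min B = (LEAST s. s \<in> singular_values B)"

text \<open>The library notion concerns families indexed by a time parameter; here the family is
  constant.\<close>

definition locally_lipschitz :: "('a::metric_space \<Rightarrow> 'b::metric_space) \<Rightarrow> bool"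
  where "locally_lipschitz F \<longleftrightarrow> local_lipschitz (UNIV :: real set) UNIV (\<lambda>_. F)"

definition lip_const :: "('a::metric_space) set \<Rightarrow> ('a \<Rightarrow> 'b::metric_space) \<Rightarrow> real"
  where "lip_const S F = Sup {dist (F y) (F z) / dist y z | y z. y \<in> S \<and> z \<in> S \<and> y \<noteq> z}"

definition local_minimizer_on :: "('a::metric_space) set \<Rightarrow> ('a \<Rightarrow> real) \<Rightarrow> 'a \<Rightarrow> bool"
  where "local_minimizer_on S \<phi> z \<longleftrightarrow>
    z \<in> S \<and> (\<exists>\<delta>>0. \<forall>y\<in>S. dist y z < \<delta> \<longrightarrow> \<phi> z \<le> \<phi> y)"

definition feasible :: "(real^'n \<Rightarrow> real^'p) \<Rightarrow> (real^'n) set"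
  where "feasible c = {x. c x = 0}"

definition cdf :: "(real^'n \<Rightarrow> real) \<Rightarrow> (real^'n \<Rightarrow> real^'p) \<Rightarrow> (real^'n \<Rightarrow> real^'n) \<Rightarrow> real
    \<Rightarrow> real^'n \<Rightarrow> real"
  where "cdf f c A \<beta> x = f (A x) + \<beta> / 2 * (norm (c x))\<^sup>2"

definition sigma_c :: "(real^'n \<Rightarrow> real^'p) \<Rightarrow> real^'n \<Rightarrow> real"
  where "sigma_c c x = sigma_min (tjac c x)"

definition rho :: "(real^'n \<Rightarrow> real^'p) \<Rightarrow> real^'n \<Rightarrow> real"
  where "rho c x = (GREATEST \<rho>. 0 < \<rho> \<and> \<rho> \<le> 1 \<and>
    (INF y\<in>cball x \<rho>. sigma_min (tjac c y)) \<ge> 1 / 2 * sigma_min (tjac c x))"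

definition Theta :: "(real^'n \<Rightarrow> real^'p) \<Rightarrow> real^'n \<Rightarrow> (real^'n) set"
  where "Theta c x = cball x (rho c x)"

definition M_f :: "(real^'n \<Rightarrow> real) \<Rightarrow> (real^'n \<Rightarrow> real^'p) \<Rightarrow> (real^'n \<Rightarrow> real^'n)
    \<Rightarrow> real^'n \<Rightarrow> real"
  where "M_f f c A x = (SUP y\<in>Theta c x. norm (grad f (A y)))"

definition M_c :: "(real^'n \<Rightarrow> real^'p) \<Rightarrow> real^'n \<Rightarrow> real"
  where "M_c c x = (SUP y\<in>Theta c x. norm (matop (tjac c y)))"

definition M_A :: "(real^'n \<Rightarrow> real^'p) \<Rightarrow> (real^'n \<Rightarrow> real^'n) \<Rightarrow> real^'n \<Rightarrow> real"
  where "M_A c A x = (SUP y\<in>Theta c x. norm (matop (tjac A y)))"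

definition L_g :: "(real^'n \<Rightarrow> real) \<Rightarrow> (real^'n \<Rightarrow> real^'p) \<Rightarrow> (real^'n \<Rightarrow> real^'n)
    \<Rightarrow> real^'n \<Rightarrow> real"
  where "L_g f c A x = lip_const (Theta c x) (grad (\<lambda>y. f (A y)))"

definition L_c :: "(real^'n \<Rightarrow> real^'p) \<Rightarrow> real^'n \<Rightarrow> real"
  where "L_c c x = lip_const (Theta c x) (\<lambda>y. matop (tjac c y))"

definition L_A :: "(real^'n \<Rightarrow> real^'p) \<Rightarrow> (real^'n \<Rightarrow> real^'n) \<Rightarrow> real^'n \<Rightarrow> real"
  where "L_A c A x = lip_const (Theta c x) (\<lambda>y. matop (tjac A y))"

definition L_b :: "(real^'n \<Rightarrow> real^'p) \<Rightarrow> (real^'n \<Rightarrow> real^'n) \<Rightarrow> real^'n \<Rightarrow> real"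
  where "L_b c A x = lip_const (Theta c x) (\<lambda>y. matop (tjac A y ** tjac c (A y)))"

text \<open>Fractions with zero denominator count as infinite, unlike division on the reals.\<close>

definition frac_inf :: "real \<Rightarrow> real \<Rightarrow> ereal"
  where "frac_inf a b = (if b = 0 then \<infinity> else ereal (a / b))"

definition eps :: "(real^'n \<Rightarrow> real^'p) \<Rightarrow> (real^'n \<Rightarrow> real^'n) \<Rightarrow> real^'n \<Rightarrow> real"
  where "eps c A x = real_of_ereal (Min {ereal (rho c x / 2),
    frac_inf (sigma_c c x) (32 * L_c c x * (M_A c A x + 1)),
    frac_inf ((sigma_c c x)\<^sup>2) (8 * L_b c A x * M_c c x)})"

definition Omega_bar :: "(real^'n \<Rightarrow> real^'p) \<Rightarrow> (real^'n \<Rightarrow> real^'n) \<Rightarrow> real^'n \<Rightarrow> (real^'n) set"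
  where "Omega_bar c A x =
    cball x (sigma_c c x * eps c A x / (4 * M_c c x * (M_A c A x + 1) + sigma_c c x))"

definition beta_threshold :: "(real^'n \<Rightarrow> real) \<Rightarrow> (real^'n \<Rightarrow> real^'p) \<Rightarrow> (real^'n \<Rightarrow> real^'n)
    \<Rightarrow> real^'n \<Rightarrow> real"
  where "beta_threshold f c A x = Max {
    128 * L_g f c A x * (M_A c A x + 1)\<^sup>2 / (sigma_c c x)\<^sup>2,
    64 * M_f f c A x * (M_A c A x + 1) * L_b c A x / (sigma_c c x) ^ 3,
    16 * M_f f c A x * L_A c A x * (2 * M_A c A x + 1) / (sigma_c c x)\<^sup>2}"

end

theory Submission
  imports Defs
begin

text \<open>
  On the feasible set the penalty function \<open>h = cdf f c A \<beta>\<close> coincides with \<open>f\<close>, since \<open>A\<close> is the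
  identity there. Hence a local minimiser of \<open>h\<close> that happens to be feasible is a local minimiser of the
  constrained problem, and two claims remain: a stationary point of \<open>h\<close> in \<open>Omega_bar\<close> is feasible, and
  the penalty prevents \<open>h\<close> from dropping below its value at a constrained minimiser.

  Both claims rest on a local error bound: near \<open>x\<close>, every point \<open>y\<close> has a feasible point within
  distance \<open>3 \<parallel>c y\<parallel> / \<sigma>\<close> (\<open>feasible_near\<close>). It holds because \<open>\<parallel>c\<parallel>\<close> has slope at least \<open>\<sigma> / 2\<close> wherever \<open>c\<close>
  does not vanish, so that a minimiser of \<open>\<parallel>c u\<parallel> + \<sigma> / 3 \<parallel>y - u\<parallel>\<close> must be a zero of \<open>c\<close>
  (\<open>zero_near_point\<close>).

  For the first claim, the error bound shows that the derivative of \<open>A\<close> fixes tangent vectors of the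
  feasible set, and together with \<open>J\<^sub>A J\<^sub>c = 0\<close> this makes \<open>J\<^sub>A\<close> idempotent at feasible points
  (\<open>JA_idempotent\<close>). At a stationary point \<open>z\<close> we have \<open>J\<^sub>A \<nabla>f(A z) = - \<beta> J\<^sub>c c(z)\<close>. Apply \<open>I - J\<^sub>A\<close> to both
  sides. On the left the result is of the order of the distance from \<open>z\<close> to the feasible set, by near
  idempotence, hence of the order of \<open>\<parallel>c z\<parallel>\<close>; on the right it is of the order of \<open>\<beta> \<parallel>c z\<parallel>\<close>, since
  \<open>J\<^sub>A J\<^sub>c\<close> is nearly zero. A large \<open>\<beta>\<close> forces \<open>c z = 0\<close> (\<open>stationary_imp_feasible\<close>).

  For the second claim, \<open>J\<^sub>A J\<^sub>c = 0\<close> says that \<open>c \<circ> A\<close> vanishes to second order on the feasible set, so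
  \<open>\<parallel>c (A y)\<parallel>\<close> is of the order of \<open>\<parallel>c y\<parallel>\<^sup>2\<close>, and the error bound at \<open>A y\<close> gives a feasible point \<open>w\<close> at a
  distance of that order from \<open>A y\<close>. Therefore \<open>f (A y)\<close> is at least \<open>f w\<close> minus a multiple of \<open>\<parallel>c y\<parallel>\<^sup>2\<close>,
  which the term \<open>\<beta> / 2 \<parallel>c y\<parallel>\<^sup>2\<close> compensates (\<open>feasible_minimizer_imp_cdf_minimizer\<close>).
\<close>

section \<open>Smallest singular value and operator norm\<close>

lemma inner_matrix_mult: "(B *v u) \<bullet> v = u \<bullet> (transpose B *v v)" for B :: "real^'m^'n"
  by (metis dot_lmul_matrix inner_commute vector_transpose_matrix)

text \<open>Compactness of the unit sphere gives the minimiser, and homogeneity carries the bound from the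
  sphere to the whole space.\<close>

lemma norm_mult_attains_min:
  fixes B :: "real^'m^'n"
  obtains v where "norm v = 1" "\<And>u. norm (B *v v) * norm u \<le> norm (B *v u)"
proof -
  have "sphere (0::real^'m) 1 \<noteq> {}" by simp
  moreover have "continuous_on (sphere 0 1) (\<lambda>v. norm (B *v v))"
    by (intro continuous_intros linear_continuous_on) auto
  ultimately obtain v where v: "norm v = 1"
    and min: "\<And>u. norm u = 1 \<Longrightarrow> norm (B *v v) \<le> norm (B *v u)"
    using continuous_attains_inf[of "sphere (0::real^'m) 1" "\<lambda>v. norm (B *v v)"]
    by (metis compact_sphere dist_0_norm mem_sphere)
  have "norm (B *v v) * norm u \<le> norm (B *v u)" for u
  proof (cases "u = 0")
    case False
    have "norm (B *v v) \<le> norm (B *v (u /\<^sub>R norm u))"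
      using False by (intro min) simp
    also have "\<dots> = norm (B *v u) / norm u"
      using False by (simp add: matrix_vector_mult_scaleR divide_inverse mult.commute)
    finally show ?thesis using False by (simp add: field_simps)
  qed simp
  with v show thesis by (rule that)
qed

text \<open>A minimiser of \<open>\<parallel>B v\<parallel>\<close> over the unit sphere is an eigenvector of the Gram matrix because the
  quadratic form \<open>\<parallel>B u\<parallel>\<^sup>2 - m\<^sup>2 \<parallel>u\<parallel>\<^sup>2\<close>, with \<open>m\<close> the minimum, is nonnegative and vanishes there, so that its gradient
  vanishes there as well; no singular value is smaller, by evaluating at its own eigenvector.\<close>

lemma sigma_min_attained:
  fixes B :: "real^'m^'n"
  obtains v where "norm v = 1" "norm (B *v v) = sigma_min B"
    "\<And>u. sigma_min B * norm u \<le> norm (B *v u)"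
proof -
  obtain v where v: "norm v = 1" and min: "\<And>u. norm (B *v v) * norm u \<le> norm (B *v u)"
    using norm_mult_attains_min[of B] by blast
  define m where "m = norm (B *v v)"
  define g where "g = (transpose B ** B) *v v - m\<^sup>2 *\<^sub>R v"
  have gram: "(B *v u) \<bullet> (B *v w) = u \<bullet> ((transpose B ** B) *v w)" for u w
    by (simp add: inner_matrix_mult matrix_vector_mul_assoc)
  have "g = 0"
  proof -
    define q where "q = (\<lambda>u. (norm (B *v u))\<^sup>2 - m\<^sup>2 * (norm u)\<^sup>2)"
    have "(m * norm u)\<^sup>2 \<le> (norm (B *v u))\<^sup>2" for u
      using min[of u] by (intro power_mono) (auto simp: m_def)
    then have q: "q u \<ge> 0" for u by (simp add: q_def power_mult_distrib)
    have q_alt: "q = (\<lambda>u. u \<bullet> ((transpose B ** B) *v u) - m\<^sup>2 * (u \<bullet> u))"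
      by (simp add: q_def power2_norm_eq_inner gram)
    have sym: "v \<bullet> ((transpose B ** B) *v h) = h \<bullet> ((transpose B ** B) *v v)" for h
      by (metis gram inner_commute)
    have "(q has_derivative (\<lambda>h. v \<bullet> ((transpose B ** B) *v h) + h \<bullet> ((transpose B ** B) *v v)
        - m\<^sup>2 * (v \<bullet> h + h \<bullet> v))) (at v)"
      unfolding q_alt by (intro derivative_intros bounded_linear.has_derivative[OF matrix_vector_mul_bounded_linear])
    moreover have "(\<lambda>h. v \<bullet> ((transpose B ** B) *v h) + h \<bullet> ((transpose B ** B) *v v)
        - m\<^sup>2 * (v \<bullet> h + h \<bullet> v)) = (\<lambda>h. 2 * (h \<bullet> g))"
      unfolding sym g_def by (simp add: inner_diff_right inner_commute[of v] algebra_simps)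
    ultimately have "(q has_derivative (\<lambda>h. 2 * (h \<bullet> g))) (at v)" by simp
    moreover have "\<forall>\<^sub>F y in at v. q v \<le> q y"
      using q v by (simp add: q_def m_def)
    ultimately have "(\<lambda>h. 2 * (h \<bullet> g)) = (\<lambda>h. 0)" by (rule has_derivative_local_min)
    then have "2 * (g \<bullet> g) = 0" by metis
    then show "g = 0" by simp
  qed
  then have "m \<in> singular_values B"
    using v unfolding singular_values_def g_def by (auto simp: m_def intro!: exI[of _ v])
  moreover have "m \<le> s" if "s \<in> singular_values B" for s
  proof -
    from that obtain w where s: "s \<ge> 0" and w: "w \<noteq> 0" "(transpose B ** B) *v w = s\<^sup>2 *\<^sub>R w"
      by (auto simp: singular_values_def)
    have "(norm (B *v w))\<^sup>2 = (s * norm w)\<^sup>2"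
      unfolding power2_norm_eq_inner power_mult_distrib by (simp add: gram w)
    then have "norm (B *v w) = s * norm w"
      using s by (simp add: power2_eq_iff_nonneg)
    with min[of w] w show ?thesis by (simp add: m_def)
  qed
  ultimately have "sigma_min B = m"
    unfolding sigma_min_def by (rule Least_equality)
  with v min that show thesis by (metis m_def)
qed

text \<open>The right-hand side is a closed condition on \<open>B\<close> for each \<open>v\<close>, so lower bounds on \<open>sigma_min\<close> pass to
  limits of matrices.\<close>

lemma le_sigma_min_iff: "s \<le> sigma_min B \<longleftrightarrow> (\<forall>v. s * norm v \<le> norm (B *v v))"
  for B :: "real^'m^'n"
proof
  obtain v where v: "norm v = 1" "norm (B *v v) = sigma_min B"
    and m: "\<And>u. sigma_min B * norm u \<le> norm (B *v u)" by (rule sigma_min_attained[of B]) auto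
  show "s \<le> sigma_min B \<Longrightarrow> \<forall>v. s * norm v \<le> norm (B *v v)"
    using m by (meson mult_right_mono norm_ge_zero order_trans)
  show "\<forall>v. s * norm v \<le> norm (B *v v) \<Longrightarrow> s \<le> sigma_min B"
    using v by (metis mult.right_neutral)
qed

lemma sigma_min_pos:
  fixes B :: "real^'m^'n"
  assumes "rank B = CARD('m)"
  shows "sigma_min B > 0"
proof -
  obtain v where v: "norm v = 1" "norm (B *v v) = sigma_min B"
    by (rule sigma_min_attained[of B])
  have "inj ((*v) B)" using assms by (simp add: full_rank_injective)
  then have "B *v v \<noteq> 0" using v(1) by (metis injD matrix_vector_mult_0_right norm_zero zero_neq_one)
  then show ?thesis using v(2) by (metis zero_less_norm_iff)
qed

lemma sigma_min_nonneg: "sigma_min B \<ge> 0" for B :: "real^'m^'n"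
  by (simp add: le_sigma_min_iff)

lemma matop_apply [simp]: "blinfun_apply (matop B) v = B *v v" for B :: "real^'m^'n"
  by (simp add: matop_def bounded_linear_Blinfun_apply)

lemma norm_mult_le: "norm (B *v v) \<le> norm (matop B) * norm v" for B :: "real^'m^'n"
  using norm_blinfun[of "matop B" v] by simp

lemma norm_transpose_mult_le: "norm (transpose B *v v) \<le> norm (matop B) * norm v" for B :: "real^'m^'n"
proof -
  let ?w = "transpose B *v v"
  have "norm ?w * norm ?w = (B *v ?w) \<bullet> v"
    by (metis inner_matrix_mult norm_eq_sqrt_inner power2_norm_eq_inner power2_eq_square)
  also have "\<dots> \<le> norm (matop B) * norm ?w * norm v"
    by (meson norm_cauchy_schwarz norm_mult_le mult_right_mono norm_ge_zero order_trans)
  finally have "norm ?w * norm ?w \<le> (norm (matop B) * norm v) * norm ?w"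
    by (simp only: mult_ac)
  then show ?thesis
    using mult_right_le_imp_le[of "norm ?w" "norm ?w"] by (cases "?w = 0") simp_all
qed

lemma sigma_min_le_norm: "sigma_min B \<le> norm (matop B)" for B :: "real^'m^'n"
proof -
  obtain v where "norm v = 1" "norm (B *v v) = sigma_min B"
    by (rule sigma_min_attained[of B])
  then show ?thesis using norm_mult_le[of B v] by simp
qed

lemma matop_mult: "matop (B ** C) = matop B o\<^sub>L matop C" for B :: "real^'m^'n" and C :: "real^'k^'m"
  by (rule blinfun_eqI) (simp add: matrix_vector_mul_assoc)

lemma matop_0 [simp]: "matop 0 = 0"
  by (rule blinfun_eqI) simp

lemma matop_diff: "matop (B - C) = matop B - matop C" for B :: "real^'m^'n"
  by (rule blinfun_eqI) (simp add: matrix_vector_mult_diff_rdistrib blinfun.diff_left)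

section \<open>Gradients, Jacobians and mean value estimates\<close>

lemma GDERIV_grad:
  fixes f :: "'a::euclidean_space \<Rightarrow> real"
  assumes "f differentiable (at y)"
  shows "GDERIV f y :> grad f y"
proof -
  obtain f' where f': "(f has_derivative f') (at y)" using assms by (auto simp: differentiable_def)
  have "f' = (\<lambda>h. h \<bullet> adjoint f' 1)"
    using adjoint_works[OF has_derivative_linear[OF f'], of _ 1] by (simp add: fun_eq_iff)
  then have gd: "GDERIV f y :> adjoint f' 1"
    using f' by (simp add: gderiv_def)
  have uniq: "D = E" if "GDERIV f y :> D" "GDERIV f y :> E" for D E
  proof -
    have "h \<bullet> D = h \<bullet> E" for h
      using has_derivative_unique[OF that[unfolded gderiv_def]] by (rule fun_cong)
    then show "D = E" by (subst vector_eq_ldot[symmetric]) blast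
  qed
  show ?thesis unfolding grad_def
    by (rule theI[where P = "\<lambda>D. GDERIV f y :> D", OF gd]) (rule uniq[OF _ gd])
qed

lemma has_derivative_tjac:
  fixes F :: "real^'n \<Rightarrow> real^'m"
  assumes "F differentiable (at y)"
  shows "(F has_derivative (\<lambda>h. transpose (tjac F y) *v h)) (at y)"
  using assms by (simp add: tjac_def jacobian_works)

lemma mean_value_bound:
  fixes F :: "'a::real_normed_vector \<Rightarrow> 'b::real_normed_vector"
  assumes "convex S" and F: "\<And>u. u \<in> S \<Longrightarrow> (F has_derivative F' u) (at u)"
    and B: "\<And>u h. u \<in> S \<Longrightarrow> norm (F' u h) \<le> B * norm h" "0 \<le> B" and "y \<in> S" "z \<in> S"
  shows "norm (F y - F z) \<le> B * norm (y - z)"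
proof (rule differentiable_bound[OF \<open>convex S\<close> _ _ \<open>y \<in> S\<close> \<open>z \<in> S\<close>])
  show "(F has_derivative F' u) (at u within S)" if "u \<in> S" for u
    using F[OF that] by (rule has_derivative_at_withinI)
  show "onorm (F' u) \<le> B" if "u \<in> S" for u
    using B that by (intro onorm_bound)
qed

text \<open>Both functions vanish at \<open>p\<close>, so the inequality survives division by \<open>t\<close> and the passage to the limit
  in the difference quotients along \<open>v\<close>. In particular \<open>D'\<close> vanishes on the kernel of \<open>F'\<close>.\<close>

lemma derivative_le_of_norm_le:
  fixes D :: "'a::real_normed_vector \<Rightarrow> 'b::real_normed_vector"
    and F :: "'a \<Rightarrow> 'c::real_normed_vector"
  assumes D: "(D has_derivative D') (at p)" and F: "(F has_derivative F') (at p)"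
    and "D p = 0" "F p = 0" and le: "\<forall>\<^sub>F y in nhds p. norm (D y) \<le> K * norm (F y)"
  shows "norm (D' v) \<le> K * norm (F' v)"
proof -
  have quot: "((\<lambda>t. norm (G (p + t *\<^sub>R v)) / t) \<longlongrightarrow> norm (G' v)) (at_right 0)"
    if G: "(G has_derivative G') (at p)" and "G p = 0" for G :: "'a \<Rightarrow> 'd::real_normed_vector" and G'
  proof -
    have "((\<lambda>t. p + t *\<^sub>R v) has_derivative (\<lambda>t. t *\<^sub>R v)) (at 0)"
      by (auto intro!: derivative_eq_intros)
    then have "((\<lambda>t. G (p + t *\<^sub>R v)) has_derivative (\<lambda>t. G' (t *\<^sub>R v))) (at 0)"
      using G by (intro has_derivative_compose[where f = "\<lambda>t. p + t *\<^sub>R v" and g = G]) simp_all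
    then have "((\<lambda>t. G (p + t *\<^sub>R v)) has_derivative (\<lambda>t. G' (t *\<^sub>R v))) (at_right 0)"
      by (rule has_derivative_at_withinI)
    then have "((\<lambda>t. (1 / \<bar>t\<bar>) *\<^sub>R (G (p + t *\<^sub>R v) - t *\<^sub>R G' v)) \<longlongrightarrow> 0) (at_right 0)"
      using \<open>G p = 0\<close> has_derivative_linear[OF G] by (simp add: has_derivative_within linear_scale)
    moreover have "\<forall>\<^sub>F t in at_right 0.
        (1 / \<bar>t\<bar>) *\<^sub>R (G (p + t *\<^sub>R v) - t *\<^sub>R G' v) = (1 / t) *\<^sub>R G (p + t *\<^sub>R v) - G' v"
      using eventually_at_right_less[of 0] by eventually_elim (simp add: scaleR_diff_right)
    ultimately have "((\<lambda>t. (1 / t) *\<^sub>R G (p + t *\<^sub>R v) - G' v) \<longlongrightarrow> 0) (at_right 0)"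
      by (rule Lim_transform_eventually)
    then have "((\<lambda>t. norm ((1 / t) *\<^sub>R G (p + t *\<^sub>R v))) \<longlongrightarrow> norm (G' v)) (at_right 0)"
      by (intro tendsto_norm) (rule LIM_zero_cancel)
    moreover have "\<forall>\<^sub>F t in at_right 0. norm ((1 / t) *\<^sub>R G (p + t *\<^sub>R v)) = norm (G (p + t *\<^sub>R v)) / t"
      using eventually_at_right_less[of 0] by eventually_elim simp
    ultimately show ?thesis by (rule Lim_transform_eventually)
  qed
  have "((\<lambda>t. p + t *\<^sub>R v) \<longlongrightarrow> p + 0 *\<^sub>R v) (at_right 0)"
    by (intro tendsto_intros)
  then have "\<forall>\<^sub>F t in at_right 0. norm (D (p + t *\<^sub>R v)) \<le> K * norm (F (p + t *\<^sub>R v))"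
    using le by (intro eventually_compose_filterlim[where f = "\<lambda>t. p + t *\<^sub>R v"]) simp_all
  with eventually_at_right_less[of 0]
  have "\<forall>\<^sub>F t in at_right 0. norm (D (p + t *\<^sub>R v)) / t \<le> K * (norm (F (p + t *\<^sub>R v)) / t)"
    by eventually_elim (simp add: field_simps)
  with quot[OF D \<open>D p = 0\<close>] tendsto_mult_left[OF quot[OF F \<open>F p = 0\<close>], of K] show ?thesis
    by (intro tendsto_le[OF trivial_limit_at_right_real])
qed

section \<open>A local error bound for equations\<close>

text \<open>The direction \<open>- adjoint F' (F p)\<close> is the steepest descent direction of \<open>\<parallel>F\<parallel>\<close>. Per unit length, the
  norm decreases there at a rate of at least \<open>s\<close>, which beats the cost \<open>a < s\<close> of moving.\<close>

lemma norm_decreases_along_adjoint: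
  fixes F :: "'a::euclidean_space \<Rightarrow> 'b::euclidean_space"
  assumes F: "(F has_derivative F') (at p)" and "F p \<noteq> 0"
    and s: "s * norm (F p) \<le> norm (adjoint F' (F p))" and "0 \<le> a" "a < s"
  obtains d where "d > 0" "\<And>t. 0 < t \<Longrightarrow> t < d \<Longrightarrow>
    norm (F (p - t *\<^sub>R adjoint F' (F p))) + a * (t * norm (adjoint F' (F p))) < norm (F p)"
proof -
  define g where "g = adjoint F' (F p)"
  have "0 < s * norm (F p)" using assms by simp
  then have "g \<noteq> 0" using s unfolding g_def by auto
  have lin: "linear F'" using F by (rule has_derivative_linear)
  have "((\<lambda>t. p - t *\<^sub>R g) has_derivative (\<lambda>t. - (t *\<^sub>R g))) (at 0)"
    by (auto intro!: derivative_eq_intros)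
  then have Fl: "((\<lambda>t. F (p - t *\<^sub>R g)) has_derivative (\<lambda>t. F' (- (t *\<^sub>R g)))) (at 0)"
    using F by (intro has_derivative_compose[where f = "\<lambda>t. p - t *\<^sub>R g" and g = F]) simp_all
  have "((\<lambda>t. norm (F (p - t *\<^sub>R g))) has_derivative (\<lambda>t. F' (- (t *\<^sub>R g)) \<bullet> sgn (F p))) (at 0)"
    using has_derivative_compose[OF Fl has_derivative_norm] \<open>F p \<noteq> 0\<close> by simp
  moreover have "F' (- (t *\<^sub>R g)) \<bullet> sgn (F p) = - ((norm g)\<^sup>2 / norm (F p)) * t" for t
  proof -
    have "F' g \<bullet> F p = (norm g)\<^sup>2"
      using adjoint_works[OF lin, of g "F p"] by (simp add: g_def power2_norm_eq_inner)
    then show ?thesis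
      using lin by (simp add: linear_neg linear_scale sgn_div_norm divide_inverse mult_ac)
  qed
  ultimately have "((\<lambda>t. norm (F (p - t *\<^sub>R g))) has_real_derivative - ((norm g)\<^sup>2 / norm (F p))) (at 0)"
    unfolding has_field_derivative_def by (simp only:)
  then have "((\<lambda>t. norm (F (p - t *\<^sub>R g)) + a * (t * norm g)) has_real_derivative
      (- ((norm g)\<^sup>2 / norm (F p)) + a * norm g)) (at 0)"
    by (auto intro!: derivative_eq_intros)
  moreover have "- ((norm g)\<^sup>2 / norm (F p)) + a * norm g < 0"
  proof -
    have "a * norm (F p) < s * norm (F p)" using assms by simp
    also have "\<dots> \<le> norm g" using s by (simp add: g_def)
    finally have "a * norm (F p) * norm g < norm g * norm g" using \<open>g \<noteq> 0\<close> by simp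
    then show ?thesis using \<open>F p \<noteq> 0\<close> by (simp add: field_simps power2_eq_square)
  qed
  ultimately have "\<exists>d>0. \<forall>h>0. h < d \<longrightarrow> norm (F (p - 0 *\<^sub>R g)) + a * (0 * norm g) >
      norm (F (p - (0 + h) *\<^sub>R g)) + a * ((0 + h) * norm g)"
    by (rule DERIV_neg_dec_right)
  then obtain d where "d > 0" and d: "\<And>h. 0 < h \<Longrightarrow> h < d \<Longrightarrow>
      norm (F (p - h *\<^sub>R g)) + a * (h * norm g) < norm (F p)"
    by auto
  then show thesis using that[of d] by (simp add: g_def)
qed

text \<open>The zero is a minimiser \<open>p\<close> of \<open>\<parallel>F u\<parallel> + a \<parallel>y - u\<parallel>\<close> over the closed ball, as in the variational
  principle of Ekeland. It satisfies the distance bound by comparison with \<open>u = y\<close>,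
  hence is an interior point, and at an interior point with \<open>F p \<noteq> 0\<close> the descent direction would
  lower the objective.\<close>

lemma zero_near_point:
  fixes F :: "'a::euclidean_space \<Rightarrow> 'b::euclidean_space"
  assumes F: "\<And>u. (F has_derivative F' u) (at u)"
    and s: "\<And>u v. u \<in> ball z r \<Longrightarrow> s * norm v \<le> norm (adjoint (F' u) v)"
    and "0 < a" "a < s" and y: "dist z y + norm (F y) / a < r"
  obtains p where "F p = 0" "a * dist y p \<le> norm (F y)" "p \<in> ball z r"
proof -
  define \<phi> where "\<phi> = (\<lambda>u. norm (F u) + a * dist y u)"
  have "continuous_on UNIV F"
    using has_derivative_continuous[OF F] by (simp add: continuous_at_imp_continuous_on)
  then have "continuous_on (cball z r) \<phi>"
    unfolding \<phi>_def by (intro continuous_intros) (auto elim: continuous_on_subset)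
  moreover have "y \<in> cball z r" 
  proof -
    have "norm (F y) / a \<ge> 0" using \<open>0 < a\<close> by simp
    with y show ?thesis by simp
  qed
  ultimately obtain p where p: "p \<in> cball z r" and min: "\<And>u. u \<in> cball z r \<Longrightarrow> \<phi> p \<le> \<phi> u"
    using continuous_attains_inf[of "cball z r" \<phi>] by (metis compact_cball empty_iff)
  have "a * dist y p \<le> norm (F y)"
    using min[OF \<open>y \<in> cball z r\<close>] norm_ge_zero[of "F p"] unfolding \<phi>_def dist_self mult_zero_right by linarith
  then have dist: "dist y p \<le> norm (F y) / a"
    using \<open>0 < a\<close> by (simp add: field_simps)
  then have ball: "p \<in> ball z r"
    using y dist_triangle[of z p y] by simp
  have "F p = 0"
  proof (rule ccontr)
    assume "F p \<noteq> 0"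
    define g where "g = adjoint (F' p) (F p)"
    obtain d where "d > 0" and d: "\<And>t. 0 < t \<Longrightarrow> t < d \<Longrightarrow>
        norm (F (p - t *\<^sub>R g)) + a * (t * norm g) < norm (F p)"
      using norm_decreases_along_adjoint[OF F[of p] \<open>F p \<noteq> 0\<close> s[OF ball] _ \<open>a < s\<close>] \<open>0 < a\<close>
      unfolding g_def by (metis less_imp_le)
    have "((\<lambda>t. p - t *\<^sub>R g) \<longlongrightarrow> p - 0 *\<^sub>R g) (at_right 0)"
      by (intro tendsto_intros)
    then have "\<forall>\<^sub>F t in at_right 0. p - t *\<^sub>R g \<in> ball z r"
      using ball by (intro topological_tendstoD) auto
    moreover have "\<forall>\<^sub>F t in at_right 0. 0 < t \<and> t < d"
      using \<open>d > 0\<close> by (simp add: eventually_at_right_less eventually_conj eventually_at_right_field) blast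
    ultimately have "\<forall>\<^sub>F t in at_right (0::real). False"
    proof eventually_elim
      case (elim t)
      have "dist y (p - t *\<^sub>R g) \<le> dist y p + t * norm g"
        using dist_triangle[of y "p - t *\<^sub>R g" p] elim by (simp add: dist_norm)
      then have "a * dist y (p - t *\<^sub>R g) \<le> a * dist y p + a * (t * norm g)"
        using \<open>0 < a\<close> by (metis distrib_left less_imp_le mult_left_mono)
      then have "\<phi> (p - t *\<^sub>R g) < \<phi> p"
        using d[of t] elim by (simp add: \<phi>_def)
      then show False using min[of "p - t *\<^sub>R g"] elim by (simp add: less_imp_le)
    qed
    then show False by simp
  qed
  with \<open>a * dist y p \<le> norm (F y)\<close> ball show thesis by (intro that)
qed

section \<open>Optimal Lipschitz constants\<close>

text \<open>A supremum over the reals is informative only for bounded sets of quotients; some Lipschitz bound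
  \<open>K\<close> is what guarantees this.\<close>

lemma lip_const_bound:
  assumes F: "K-lipschitz_on S F" and "y \<in> S" "z \<in> S"
  shows "dist (F y) (F z) \<le> lip_const S F * dist y z"
proof (cases "y = z")
  case False
  let ?Q = "{dist (F y) (F z) / dist y z | y z. y \<in> S \<and> z \<in> S \<and> y \<noteq> z}"
  have "bdd_above ?Q"
    using lipschitz_onD[OF F] by (intro bdd_aboveI[of _ K]) (auto simp: divide_le_eq)
  then have "dist (F y) (F z) / dist y z \<le> lip_const S F"
    unfolding lip_const_def using assms False by (intro cSup_upper) auto
  then show ?thesis using False by (simp add: divide_le_eq)
qed simp

lemma lip_const_nonneg:
  assumes "K-lipschitz_on S F" "y \<in> S" "z \<in> S" "y \<noteq> z"
  shows "lip_const S F \<ge> 0"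
proof -
  have "0 \<le> lip_const S F * dist y z"
    using lip_const_bound[OF assms(1-3)] zero_le_dist order_trans by blast
  then show ?thesis using assms(4) by (simp add: zero_le_mult_iff)
qed

lemma locally_lipschitz_continuous: "locally_lipschitz F \<Longrightarrow> continuous_on S F"
  unfolding locally_lipschitz_def
  using local_lipschitz_continuous_on[of UNIV UNIV "\<lambda>_::real. F" 0] continuous_on_subset by auto

lemma locally_lipschitz_on_compact:
  assumes "locally_lipschitz F" "compact S"
  obtains K where "K-lipschitz_on S F"
proof -
  have "local_lipschitz {0::real} S (\<lambda>_. F)"
    using assms(1) unfolding locally_lipschitz_def by (rule local_lipschitz_subset) auto
  then show thesis
    by (rule local_lipschitz_compact_implies_lipschitz[OF _ assms(2), of "{0}"]) (auto intro: that)
qed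

lemma norm_le_Sup_compact:
  assumes "compact S" "continuous_on S F" "y \<in> S"
  shows "norm (F y) \<le> (SUP y\<in>S. norm (F y))"
proof (rule cSUP_upper)
  show "bdd_above ((\<lambda>y. norm (F y)) ` S)"
    using assms by (intro bounded_imp_bdd_above compact_imp_bounded compact_continuous_image continuous_intros)
qed fact

lemma lipschitz_on_blinfun_compose:
  fixes F :: "'a::metric_space \<Rightarrow> ('b::real_normed_vector \<Rightarrow>\<^sub>L 'c::real_normed_vector)"
    and G :: "'a \<Rightarrow> ('d::real_normed_vector \<Rightarrow>\<^sub>L 'b)"
  assumes F: "K-lipschitz_on S F" and G: "L-lipschitz_on S G"
    and M: "\<And>y. y \<in> S \<Longrightarrow> norm (F y) \<le> M" "0 \<le> M" and N: "\<And>y. y \<in> S \<Longrightarrow> norm (G y) \<le> N" "0 \<le> N"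
  shows "(M * L + K * N)-lipschitz_on S (\<lambda>y. F y o\<^sub>L G y)"
proof (rule lipschitz_onI)
  fix y z assume yz: "y \<in> S" "z \<in> S"
  have "norm ((F y o\<^sub>L G y) - (F z o\<^sub>L G z)) = norm ((F y o\<^sub>L (G y - G z)) + ((F y - F z) o\<^sub>L G z))"
    by (intro arg_cong[where f = norm] blinfun_eqI) (simp add: blinfun.diff_left blinfun.add_left blinfun.diff_right)
  also have "\<dots> \<le> norm (F y) * norm (G y - G z) + norm (F y - F z) * norm (G z)"
    by (intro norm_triangle_le add_mono norm_blinfun_compose)
  also have "\<dots> \<le> M * (L * dist y z) + (K * dist y z) * N"
    using lipschitz_on_nonneg[OF F] lipschitz_onD[OF F yz] lipschitz_onD[OF G yz] M N yz
    by (intro add_mono mult_mono) (auto simp: dist_norm)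
  finally show "dist (F y o\<^sub>L G y) (F z o\<^sub>L G z) \<le> (M * L + K * N) * dist y z"
    by (simp add: dist_norm algebra_simps)
qed (use lipschitz_on_nonneg[OF F] lipschitz_on_nonneg[OF G] M N in simp)

section \<open>The constants of the penalty problem\<close>

locale constraint_dissolving =
  fixes f :: "real^'n \<Rightarrow> real" and c :: "real^'n \<Rightarrow> real^'p" and A :: "real^'n \<Rightarrow> real^'n"
    and x :: "real^'n"
  assumes f_diff: "f differentiable (at y)"
    and c_diff: "c differentiable (at y)"
    and A_diff: "A differentiable (at y)"
    and grad_lipschitz: "locally_lipschitz (grad f)"
    and Jc_lipschitz: "locally_lipschitz (\<lambda>y. matop (tjac c y))"
    and JA_lipschitz: "locally_lipschitz (\<lambda>y. matop (tjac A y))"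
    and full_rank: "rank (tjac c x) = CARD('p)"
    and A_fixes: "y \<in> feasible c \<Longrightarrow> A y = y"
    and JA_Jc: "y \<in> feasible c \<Longrightarrow> tjac A y ** tjac c y = 0"
    and x_feasible: "x \<in> feasible c"
begin

abbreviation "\<sigma> \<equiv> sigma_c c x"
abbreviation "\<rho> \<equiv> rho c x"
abbreviation "\<Theta> \<equiv> Theta c x"
abbreviation "Mf \<equiv> M_f f c A x"
abbreviation "Mc \<equiv> M_c c x"
abbreviation "MA \<equiv> M_A c A x"
abbreviation "Lc \<equiv> L_c c x"
abbreviation "LA \<equiv> L_A c A x"
abbreviation "Lb \<equiv> L_b c A x"
abbreviation "\<epsilon> \<equiv> eps c A x"

lemma sigma_pos: "0 < \<sigma>"
  unfolding sigma_c_def using full_rank by (rule sigma_min_pos)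

lemma continuous_c: "continuous_on S c" and continuous_A: "continuous_on S A"
  using c_diff A_diff by (simp_all add: continuous_at_imp_continuous_on differentiable_imp_continuous_within)

lemma continuous_Jc: "continuous_on S (\<lambda>y. matop (tjac c y))"
  and continuous_JA: "continuous_on S (\<lambda>y. matop (tjac A y))"
  and continuous_grad: "continuous_on S (grad f)"
  using Jc_lipschitz JA_lipschitz grad_lipschitz by (simp_all add: locally_lipschitz_continuous)

text \<open>The points where the Jacobian expands by \<open>\<sigma> / 2\<close> form a closed set \<open>E\<close>, so if all smaller balls lie in \<open>E\<close>, then so does the closed
  ball of the supremal radius; hence the greatest element in the definition of \<open>\<rho>\<close> exists. Continuity of the Jacobian provides a positive admissible radius.\<close>

lemma rho_greatest:
  "0 < \<rho> \<and> \<rho> \<le> 1 \<and> (\<forall>y\<in>cball x \<rho>. \<forall>v. \<sigma> / 2 * norm v \<le> norm (tjac c y *v v))"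
proof -
  define E where "E = {y. \<forall>v. \<sigma> / 2 * norm v \<le> norm (tjac c y *v v)}"
  define P where "P = (\<lambda>r. 0 < r \<and> r \<le> 1 \<and> cball x r \<subseteq> E)"
  have inf_iff: "(INF y\<in>cball x r. sigma_min (tjac c y)) \<ge> 1 / 2 * sigma_min (tjac c x)
      \<longleftrightarrow> cball x r \<subseteq> E" if "0 < r" for r
  proof -
    have "bdd_below ((\<lambda>y. sigma_min (tjac c y)) ` cball x r)"
      by (rule bdd_belowI[of _ 0]) (auto simp: sigma_min_nonneg)
    then show ?thesis
      using that by (subst le_cINF_iff) (auto simp: le_sigma_min_iff E_def sigma_c_def)
  qed
  then have rho_eq: "\<rho> = (GREATEST r. P r)"
    unfolding rho_def P_def by (metis (no_types, lifting))
  have "E = (\<Inter>v. {y. \<sigma> / 2 * norm v \<le> norm (blinfun_apply (matop (tjac c y)) v)})"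
    by (auto simp: E_def)
  also have "closed \<dots>"
    by (intro closed_INT ballI closed_Collect_le continuous_intros continuous_Jc)
  finally have "closed E" .
  have "\<exists>r. P r"
  proof -
    obtain d where "d > 0" and d: "\<And>y. dist y x < d \<Longrightarrow> dist (matop (tjac c y)) (matop (tjac c x)) < \<sigma> / 2"
      using continuous_Jc[of UNIV] sigma_pos unfolding continuous_on_iff
      by (metis UNIV_I half_gt_zero)
    have "y \<in> E" if "dist y x < d" for y
    proof -
      have "\<sigma> / 2 * norm v \<le> norm (tjac c y *v v)" for v
      proof -
        have "norm (tjac c x *v v) \<le> norm (tjac c y *v v) + norm ((tjac c y - tjac c x) *v v)"
          by (metis add.commute matrix_vector_mult_diff_rdistrib norm_minus_commute norm_triangle_sub)
        also have "norm ((tjac c y - tjac c x) *v v) \<le> \<sigma> / 2 * norm v"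
          using norm_mult_le[of "tjac c y - tjac c x" v] d[OF that]
          by (smt (verit) dist_norm matop_diff mult_right_mono norm_ge_zero)
        finally have "norm (tjac c x *v v) \<le> norm (tjac c y *v v) + \<sigma> / 2 * norm v" by simp
        moreover have "\<sigma> * norm v \<le> norm (tjac c x *v v)"
          using le_sigma_min_iff[of \<sigma> "tjac c x"] by (simp add: sigma_c_def)
        ultimately show ?thesis by simp
      qed
      then show ?thesis by (simp add: E_def)
    qed
    then have "P (min 1 (d / 2))" using \<open>d > 0\<close> by (auto simp: P_def dist_commute)
    then show ?thesis ..
  qed
  moreover have bdd: "bdd_above {r. P r}" by (rule bdd_aboveI[of _ 1]) (auto simp: P_def)
  ultimately have sup: "P r \<Longrightarrow> r \<le> Sup {r. P r}" for r by (simp add: cSup_upper)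
  have "P (Sup {r. P r})"
  proof -
    have "ball x (Sup {r. P r}) \<subseteq> E"
    proof
      fix y assume "y \<in> ball x (Sup {r. P r})"
      then obtain r where "P r" "dist x y < r"
        using less_cSupD[of "{r. P r}"] \<open>\<exists>r. P r\<close> by auto
      then show "y \<in> E" by (auto simp: P_def)
    qed
    moreover have "0 < Sup {r. P r}" using \<open>\<exists>r. P r\<close> sup by (force simp: P_def)
    moreover have "Sup {r. P r} \<le> 1" using \<open>\<exists>r. P r\<close> by (intro cSup_least) (auto simp: P_def)
    ultimately show ?thesis
      using \<open>closed E\<close> closure_minimal[of "ball x (Sup {r. P r})" E] by (simp add: P_def closure_ball)
  qed
  moreover from this have "\<rho> = Sup {r. P r}"
    unfolding rho_eq using sup by (rule Greatest_equality)
  ultimately show ?thesis by (auto simp: P_def E_def)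
qed

lemma rho_pos: "0 < \<rho>" and Jc_expands: "y \<in> \<Theta> \<Longrightarrow> \<sigma> / 2 * norm v \<le> norm (tjac c y *v v)"
  using rho_greatest by (auto simp: Theta_def)

lemma x_in_Theta: "x \<in> \<Theta>"
  using rho_pos by (simp add: Theta_def)

lemma compact_Theta: "compact \<Theta>" and convex_Theta: "convex \<Theta>"
  by (simp_all add: Theta_def)

lemma norm_grad_le: "y \<in> \<Theta> \<Longrightarrow> norm (grad f (A y)) \<le> Mf"
  unfolding M_f_def
  by (intro norm_le_Sup_compact[where F = "\<lambda>y. grad f (A y)"] compact_Theta
      continuous_on_compose2[OF continuous_grad continuous_A]) auto

lemma norm_Jc_le: "y \<in> \<Theta> \<Longrightarrow> norm (matop (tjac c y)) \<le> Mc"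
  unfolding M_c_def
  by (intro norm_le_Sup_compact[where F = "\<lambda>y. matop (tjac c y)"] compact_Theta continuous_Jc)

lemma norm_JA_le: "y \<in> \<Theta> \<Longrightarrow> norm (matop (tjac A y)) \<le> MA"
  unfolding M_A_def
  by (intro norm_le_Sup_compact[where F = "\<lambda>y. matop (tjac A y)"] compact_Theta continuous_JA)

lemma Mf_nonneg: "0 \<le> Mf" and MA_nonneg: "0 \<le> MA" and sigma_le_Mc: "\<sigma> \<le> Mc"
  using norm_grad_le[OF x_in_Theta] norm_JA_le[OF x_in_Theta] norm_Jc_le[OF x_in_Theta]
    sigma_min_le_norm[of "tjac c x"]
  by (auto simp: sigma_c_def intro: order_trans[OF norm_ge_zero] order_trans)

lemma A_lipschitz: "y \<in> \<Theta> \<Longrightarrow> z \<in> \<Theta> \<Longrightarrow> norm (A y - A z) \<le> MA * norm (y - z)"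
  by (rule mean_value_bound[OF convex_Theta has_derivative_tjac[OF A_diff]
        order_trans[OF norm_transpose_mult_le mult_right_mono[OF norm_JA_le norm_ge_zero]] MA_nonneg])

lemma c_lipschitz: "y \<in> \<Theta> \<Longrightarrow> z \<in> \<Theta> \<Longrightarrow> norm (c y - c z) \<le> Mc * norm (y - z)"
  using sigma_pos sigma_le_Mc
  by (intro mean_value_bound[OF convex_Theta has_derivative_tjac[OF c_diff]
        order_trans[OF norm_transpose_mult_le mult_right_mono[OF norm_Jc_le norm_ge_zero]]]) auto

text \<open>The suprema that define the Lipschitz constants need at least one difference quotient; over the
  empty set their value, and hence their sign, would be arbitrary.\<close>

lemma Theta_two_points: obtains y where "y \<in> \<Theta>" "x \<noteq> y"
proof
  let ?y = "x + \<rho> *\<^sub>R axis undefined 1"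
  show "?y \<in> \<Theta>" "x \<noteq> ?y" using rho_pos by (simp_all add: Theta_def dist_norm)
qed

lemma Jc_bound: "y \<in> \<Theta> \<Longrightarrow> z \<in> \<Theta> \<Longrightarrow> norm (matop (tjac c y - tjac c z)) \<le> Lc * norm (y - z)"
  and Lc_nonneg: "0 \<le> Lc"
proof -
  obtain K where "K-lipschitz_on \<Theta> (\<lambda>y. matop (tjac c y))"
    using locally_lipschitz_on_compact[OF Jc_lipschitz compact_Theta] by blast
  note K = lip_const_bound[OF this] lip_const_nonneg[OF this]
  show "y \<in> \<Theta> \<Longrightarrow> z \<in> \<Theta> \<Longrightarrow> norm (matop (tjac c y - tjac c z)) \<le> Lc * norm (y - z)"
    using K(1) by (simp add: matop_diff dist_norm L_c_def)
  show "0 \<le> Lc"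
    using K(2)[OF x_in_Theta] Theta_two_points unfolding L_c_def by metis
qed

lemma JA_bound: "y \<in> \<Theta> \<Longrightarrow> z \<in> \<Theta> \<Longrightarrow> norm (matop (tjac A y - tjac A z)) \<le> LA * norm (y - z)"
  and LA_nonneg: "0 \<le> LA"
proof -
  obtain K where "K-lipschitz_on \<Theta> (\<lambda>y. matop (tjac A y))"
    using locally_lipschitz_on_compact[OF JA_lipschitz compact_Theta] by blast
  note K = lip_const_bound[OF this] lip_const_nonneg[OF this]
  show "y \<in> \<Theta> \<Longrightarrow> z \<in> \<Theta> \<Longrightarrow> norm (matop (tjac A y - tjac A z)) \<le> LA * norm (y - z)"
    using K(1) by (simp add: matop_diff dist_norm L_A_def)
  show "0 \<le> LA"
    using K(2)[OF x_in_Theta] Theta_two_points unfolding L_A_def by metis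
qed

text \<open>Local Lipschitz continuity of \<open>tjac c\<close> must be used on the compact image of \<open>\<Theta>\<close> under \<open>A\<close>, which
  may leave \<open>\<Theta>\<close>.\<close>

lemma JA_Jc_lipschitz: obtains K where "K-lipschitz_on \<Theta> (\<lambda>y. matop (tjac A y ** tjac c (A y)))"
proof -
  obtain K where K: "K-lipschitz_on \<Theta> (\<lambda>y. matop (tjac A y))"
    using locally_lipschitz_on_compact[OF JA_lipschitz compact_Theta] by blast
  have comp: "compact (A ` \<Theta>)"
    by (rule compact_continuous_image[OF continuous_A compact_Theta])
  obtain L where L: "L-lipschitz_on (A ` \<Theta>) (\<lambda>y. matop (tjac c y))"
    using locally_lipschitz_on_compact[OF Jc_lipschitz comp] by blast
  have "MA-lipschitz_on \<Theta> A"
    using A_lipschitz MA_nonneg by (intro lipschitz_onI) (auto simp: dist_norm)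
  then have L': "(L * MA)-lipschitz_on \<Theta> (\<lambda>y. matop (tjac c (A y)))"
    using L by (rule lipschitz_on_compose2)
  define N where "N = (SUP y\<in>A ` \<Theta>. norm (matop (tjac c y)))"
  have N: "norm (matop (tjac c (A y))) \<le> N" if "y \<in> \<Theta>" for y
    unfolding N_def using that
    by (intro norm_le_Sup_compact[where F = "\<lambda>y. matop (tjac c y)"] comp continuous_Jc) auto
  then have "0 \<le> N" using x_in_Theta norm_ge_zero order_trans by blast
  from lipschitz_on_blinfun_compose[OF K L' norm_JA_le MA_nonneg N this] show thesis
    using that by (simp add: matop_mult)
qed

text \<open>The product vanishes at feasible points, so its Lipschitz constant measures its size by the distance
  to a feasible point.\<close>

lemma JA_Jc_bound:
    "y \<in> \<Theta> \<Longrightarrow> p \<in> \<Theta> \<Longrightarrow> p \<in> feasible c \<Longrightarrow> norm (matop (tjac A y ** tjac c (A y))) \<le> Lb * norm (y - p)"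
  and Lb_nonneg: "0 \<le> Lb"
proof -
  obtain K where "K-lipschitz_on \<Theta> (\<lambda>y. matop (tjac A y ** tjac c (A y)))"
    by (rule JA_Jc_lipschitz)
  note K = lip_const_bound[OF this] lip_const_nonneg[OF this]
  show "y \<in> \<Theta> \<Longrightarrow> p \<in> \<Theta> \<Longrightarrow> p \<in> feasible c \<Longrightarrow> norm (matop (tjac A y ** tjac c (A y))) \<le> Lb * norm (y - p)"
    using K(1)[of y p] by (simp add: dist_norm L_b_def A_fixes JA_Jc)
  show "0 \<le> Lb"
    using K(2)[OF x_in_Theta] Theta_two_points unfolding L_b_def by metis
qed

lemma frac_inf_bound:
  assumes "0 \<le> a" "0 \<le> b"
  shows "0 \<le> frac_inf a b" and "ereal e \<le> frac_inf a b \<Longrightarrow> b * e \<le> a"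
  using assms by (auto simp: frac_inf_def field_simps split: if_splits)

text \<open>The minimum is taken in the extended reals, but the first entry keeps it finite; multiplied out, the
  bounds also cover zero denominators.\<close>

lemma eps_nonneg: "0 \<le> \<epsilon>" and eps_le_rho: "\<epsilon> \<le> \<rho> / 2"
  and eps_Lc: "32 * Lc * (MA + 1) * \<epsilon> \<le> \<sigma>" and eps_Lb: "8 * Lb * Mc * \<epsilon> \<le> \<sigma>\<^sup>2"
proof -
  let ?X = "{ereal (\<rho> / 2), frac_inf \<sigma> (32 * Lc * (MA + 1)), frac_inf (\<sigma>\<^sup>2) (8 * Lb * Mc)}"
  have nonneg: "0 \<le> \<sigma>" "0 \<le> 32 * Lc * (MA + 1)" "0 \<le> \<sigma>\<^sup>2" "0 \<le> 8 * Lb * Mc"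
    using sigma_pos sigma_le_Mc Lc_nonneg MA_nonneg Lb_nonneg by auto
  have "0 \<le> Min ?X" using frac_inf_bound(1)[OF nonneg(1,2)] frac_inf_bound(1)[OF nonneg(3,4)] rho_pos
    by (auto simp: Min_ge_iff)
  moreover have le: "Min ?X \<le> a" if "a \<in> ?X" for a using that by (intro Min_le) auto
  then have "Min ?X \<le> ereal (\<rho> / 2)" by blast
  ultimately have eq: "ereal \<epsilon> = Min ?X"
    unfolding eps_def by (intro ereal_real') (metis abs_ereal_ge0 ereal_infty_less_eq(1) PInfty_neq_ereal(1))
  show "0 \<le> \<epsilon>" using \<open>0 \<le> Min ?X\<close> unfolding eq[symmetric] by simp
  show "\<epsilon> \<le> \<rho> / 2" using \<open>Min ?X \<le> ereal (\<rho> / 2)\<close> unfolding eq[symmetric] by simp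
  show "32 * Lc * (MA + 1) * \<epsilon> \<le> \<sigma>"
    by (rule frac_inf_bound(2)[OF nonneg(1,2)]) (unfold eq, rule le, simp)
  show "8 * Lb * Mc * \<epsilon> \<le> \<sigma>\<^sup>2"
    by (rule frac_inf_bound(2)[OF nonneg(3,4)]) (unfold eq, rule le, simp)
qed

lemma Omega_bar_dist:
  assumes "z \<in> Omega_bar c A x"
  shows "dist x z * (4 * Mc * (MA + 1) + \<sigma>) \<le> \<sigma> * \<epsilon>" and "5 * dist x z \<le> \<epsilon>" and "dist x z \<le> \<rho> / 10"
proof -
  have pos: "0 < 4 * Mc * (MA + 1) + \<sigma>"
    using sigma_pos sigma_le_Mc MA_nonneg by (intro add_nonneg_pos mult_nonneg_nonneg) auto
  then show *: "dist x z * (4 * Mc * (MA + 1) + \<sigma>) \<le> \<sigma> * \<epsilon>"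
    using assms by (simp add: Omega_bar_def pos_le_divide_eq)
  have "\<sigma> * 1 \<le> Mc * (MA + 1)"
    using sigma_pos sigma_le_Mc MA_nonneg by (intro mult_mono) auto
  then have "dist x z * (5 * \<sigma>) \<le> dist x z * (4 * Mc * (MA + 1) + \<sigma>)"
    by (intro mult_left_mono) auto
  with * have "\<sigma> * (5 * dist x z) \<le> \<sigma> * \<epsilon>" by (simp add: mult_ac)
  then show "5 * dist x z \<le> \<epsilon>" using sigma_pos by simp
  then show "dist x z \<le> \<rho> / 10" using eps_le_rho by simp
qed

section \<open>Feasible points and the retraction\<close>

text \<open>On \<open>\<Theta>\<close> the transposed Jacobian, which is the adjoint derivative of \<open>c\<close>, expands by \<open>\<sigma> / 2\<close>. The error
  bound needs a strictly smaller rate; \<open>\<sigma> / 3\<close> is small enough for this and large enough for all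
  constants below.\<close>

lemma feasible_near:
  assumes "ball u r \<subseteq> \<Theta>" and y: "dist u y + norm (c y) / (\<sigma> / 3) < r"
  obtains p where "p \<in> feasible c" "p \<in> ball u r" "\<sigma> / 3 * dist y p \<le> norm (c y)"
proof -
  have "adjoint ((*v) (transpose (tjac c w))) v = tjac c w *v v" for w v
    using adjoint_matrix[of "transpose (tjac c w)"] by (simp only: transpose_transpose)
  then have exp: "\<sigma> / 2 * norm v \<le> norm (adjoint ((*v) (transpose (tjac c w))) v)" if "w \<in> ball u r" for w v
    using Jc_expands[of w v] that assms(1) by auto
  obtain p where "c p = 0" "\<sigma> / 3 * dist y p \<le> norm (c y)" "p \<in> ball u r"
    by (rule zero_near_point[OF has_derivative_tjac[OF c_diff] exp _ _ y]) (use sigma_pos in auto)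
  then show thesis by (intro that) (auto simp: feasible_def)
qed

lemma closed_feasible: "closed (feasible c)"
  unfolding feasible_def by (intro closed_Collect_eq continuous_intros continuous_c)

lemma ball_subset_Theta: "ball u (\<rho> - dist x u) \<subseteq> \<Theta>"
proof
  fix y assume "y \<in> ball u (\<rho> - dist x u)"
  then show "y \<in> \<Theta>" using dist_triangle[of x y u] by (simp add: Theta_def)
qed

lemma eventually_small_constraint:
  assumes "continuous_on UNIV F" "F u = u" "c u = 0" "r > 0"
  shows "\<forall>\<^sub>F y in nhds u. dist u (F y) + norm (c (F y)) / (\<sigma> / 3) < r"
proof -
  have "continuous_on UNIV (\<lambda>y. dist u (F y) + norm (c (F y)) / (\<sigma> / 3))"
    using sigma_pos by (intro continuous_intros assms continuous_on_compose2[OF continuous_c assms(1)]) auto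
  then have "isCont (\<lambda>y. dist u (F y) + norm (c (F y)) / (\<sigma> / 3)) u"
    by (simp add: continuous_on_eq_continuous_at)
  then have "((\<lambda>y. dist u (F y) + norm (c (F y)) / (\<sigma> / 3)) \<longlongrightarrow> 0) (nhds u)"
    using assms(2,3) by (simp add: isCont_def tendsto_nhds_iff del: divide_divide_eq_right)
  then show ?thesis using \<open>r > 0\<close> by (rule order_tendstoD(2))
qed

text \<open>The displacement \<open>A y - y\<close> vanishes on the feasible set and is Lipschitz, so by the error bound it is
  dominated by a multiple of \<open>\<parallel>c y\<parallel>\<close> near \<open>p\<close>. Its derivative is therefore dominated by that of \<open>c\<close> and
  vanishes on the tangent space.\<close>

lemma JA_tangent:
  assumes p: "p \<in> feasible c" "dist x p < \<rho>" and v: "transpose (tjac c p) *v v = 0"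
  shows "transpose (tjac A p) *v v = v"
proof -
  define r where "r = \<rho> - dist x p"
  have sub: "ball p r \<subseteq> \<Theta>" unfolding r_def by (rule ball_subset_Theta)
  have "\<forall>\<^sub>F y in nhds p. dist p y + norm (c y) / (\<sigma> / 3) < r"
    using p eventually_small_constraint[of "\<lambda>y. y" p r] by (simp add: r_def feasible_def)
  then have "\<forall>\<^sub>F y in nhds p. norm (A y - y) \<le> (MA + 1) * 3 / \<sigma> * norm (c y)"
  proof eventually_elim
    case (elim y)
    obtain q where q: "q \<in> feasible c" "q \<in> ball p r" "\<sigma> / 3 * dist y q \<le> norm (c y)"
      by (rule feasible_near[OF sub elim])
    have "0 \<le> norm (c y) / (\<sigma> / 3)" using sigma_pos by simp
    then have "y \<in> \<Theta>" using elim sub by auto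
    have "norm (A y - y) \<le> norm (A y - A q) + norm (q - y)"
      using norm_triangle_ineq[of "A y - A q" "q - y"] A_fixes[OF q(1)] by simp
    also have "\<dots> \<le> (MA + 1) * dist y q"
      using A_lipschitz[OF \<open>y \<in> \<Theta>\<close>, of q] q(2) sub by (auto simp: dist_norm norm_minus_commute algebra_simps)
    also have "\<dots> \<le> (MA + 1) * (norm (c y) / (\<sigma> / 3))"
      using q(3) sigma_pos MA_nonneg by (intro mult_left_mono) (auto simp: field_simps)
    also have "\<dots> = (MA + 1) * 3 / \<sigma> * norm (c y)" by simp
    finally show ?case .
  qed
  moreover have "((\<lambda>y. A y - y) has_derivative (\<lambda>h. transpose (tjac A p) *v h - h)) (at p)"
    by (intro derivative_intros has_derivative_tjac A_diff)
  ultimately have "norm (transpose (tjac A p) *v v - v) \<le> (MA + 1) * 3 / \<sigma> * norm (transpose (tjac c p) *v v)"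
    using p(1) A_fixes[OF p(1)]
    by (intro derivative_le_of_norm_le[OF _ has_derivative_tjac[OF c_diff]]) (simp_all add: feasible_def)
  then show ?thesis using v by simp
qed

text \<open>The derivative of \<open>A\<close> at a feasible point maps into the tangent space, because \<open>J\<^sub>A J\<^sub>c = 0\<close>, and fixes
  it; it is a projection onto it, not necessarily an orthogonal one.\<close>

lemma JA_idempotent:
  assumes p: "p \<in> feasible c" "dist x p < \<rho>"
  shows "tjac A p ** tjac A p = tjac A p"
proof -
  have "(transpose (tjac A p) ** transpose (tjac A p)) *v h = transpose (tjac A p) *v h" for h
  proof -
    have "transpose (tjac c p) *v (transpose (tjac A p) *v h) = transpose (tjac A p ** tjac c p) *v h"
      by (simp only: matrix_transpose_mul matrix_vector_mul_assoc)
    also have "\<dots> = 0" unfolding JA_Jc[OF p(1)] by (simp add: transpose_def matrix_vector_mult_def vec_eq_iff)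
    finally show ?thesis
      using JA_tangent[OF p] by (simp only: matrix_vector_mul_assoc[symmetric])
  qed
  then have "transpose (tjac A p ** tjac A p) = transpose (tjac A p)"
    unfolding matrix_transpose_mul matrix_eq ..
  from arg_cong[OF this, of transpose] show ?thesis by (simp only: transpose_transpose)
qed

section \<open>Stationary points of the penalty function are feasible\<close>

lemma cdf_stationary:
  assumes "local_minimizer_on UNIV (cdf f c A \<beta>) z"
  shows "tjac A z *v grad f (A z) = - \<beta> *\<^sub>R (tjac c z *v c z)"
proof -
  define w where "w = tjac A z *v grad f (A z) + \<beta> *\<^sub>R (tjac c z *v c z)"
  have fA: "((\<lambda>y. f (A y)) has_derivative (\<lambda>h. (transpose (tjac A z) *v h) \<bullet> grad f (A z))) (at z)"
    using GDERIV_grad[OF f_diff, of "A z"] unfolding gderiv_def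
    by (rule has_derivative_compose[OF has_derivative_tjac[OF A_diff]])
  have "(cdf f c A \<beta> has_derivative (\<lambda>h. (transpose (tjac A z) *v h) \<bullet> grad f (A z)
      + \<beta> / 2 * (c z \<bullet> (transpose (tjac c z) *v h) + (transpose (tjac c z) *v h) \<bullet> c z))) (at z)"
    unfolding cdf_def[abs_def] power2_norm_eq_inner
    by (intro derivative_intros fA has_derivative_tjac c_diff)
  also have "(\<lambda>h. (transpose (tjac A z) *v h) \<bullet> grad f (A z)
      + \<beta> / 2 * (c z \<bullet> (transpose (tjac c z) *v h) + (transpose (tjac c z) *v h) \<bullet> c z)) = (\<lambda>h. h \<bullet> w)"
    by (simp only: inner_commute[of "c z"] inner_matrix_mult transpose_transpose w_def inner_add_right inner_scaleR_right) simp
  finally have "(cdf f c A \<beta> has_derivative (\<lambda>h. h \<bullet> w)) (at z)" .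
  moreover have "\<forall>\<^sub>F y in at z. cdf f c A \<beta> z \<le> cdf f c A \<beta> y"
    using assms unfolding local_minimizer_on_def eventually_at by auto
  ultimately have "(\<lambda>h. h \<bullet> w) = (\<lambda>h. 0)" by (rule has_derivative_local_min)
  then have "w \<bullet> w = 0" by (rule fun_cong)
  then show ?thesis by (simp add: w_def add_eq_0_iff2)
qed

text \<open>The radius of \<open>Omega_bar\<close> keeps \<open>\<parallel>c z\<parallel>\<close> small enough for the error bound to stay inside \<open>\<Theta>\<close>. The
  nearest feasible point inherits that bound and is also no farther from \<open>z\<close> than \<open>x\<close> is.\<close>

lemma feasible_near_Omega_bar:
  assumes z: "z \<in> Omega_bar c A x"
  obtains p where "p \<in> feasible c" "\<sigma> / 3 * dist z p \<le> norm (c z)" "dist z p \<le> dist x z"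
proof -
  have "z \<in> \<Theta>" using Omega_bar_dist(3)[OF z] rho_pos by (simp add: Theta_def)
  have "norm (c z) \<le> Mc * dist x z"
    using c_lipschitz[OF x_in_Theta \<open>z \<in> \<Theta>\<close>] x_feasible by (simp add: feasible_def dist_norm)
  also have "\<dots> \<le> \<sigma> * \<epsilon> / 4"
  proof -
    have "dist x z * (4 * Mc) \<le> dist x z * (4 * Mc * (MA + 1) + \<sigma>)"
      using sigma_pos sigma_le_Mc MA_nonneg by (intro mult_left_mono) (auto simp: algebra_simps)
    then have "dist x z * (4 * Mc) \<le> \<sigma> * \<epsilon>" using Omega_bar_dist(1)[OF z] by (rule order_trans)
    then show ?thesis by (simp add: mult_ac)
  qed
  also have "\<dots> \<le> \<sigma> * \<rho> / 8" using eps_le_rho sigma_pos by simp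
  finally have "norm (c z) / (\<sigma> / 3) \<le> 3 / 8 * \<rho>" using sigma_pos by (simp add: field_simps)
  then have "dist x z + norm (c z) / (\<sigma> / 3) < \<rho>"
    using Omega_bar_dist(3)[OF z] rho_pos by simp
  moreover have "ball x \<rho> \<subseteq> \<Theta>" by (auto simp: Theta_def)
  ultimately obtain q where q: "q \<in> feasible c" "\<sigma> / 3 * dist z q \<le> norm (c z)"
    using feasible_near[of x \<rho> z] by blast
  obtain p where p: "p \<in> feasible c" "\<And>y. y \<in> feasible c \<Longrightarrow> dist z p \<le> dist z y"
    using distance_attains_inf[OF closed_feasible, of z] x_feasible by blast
  show thesis
  proof
    show "\<sigma> / 3 * dist z p \<le> norm (c z)"
      using mult_left_mono[OF p(2)[OF q(1)], of "\<sigma> / 3"] q(2) sigma_pos by linarith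
    show "dist z p \<le> dist x z" using p(2)[OF x_feasible] by (simp add: dist_commute)
  qed (rule p(1))
qed

text \<open>At a feasible point \<open>J\<^sub>A J\<^sub>c\<close> is zero. Away from it, the constant \<open>L\<^sub>b\<close> controls \<open>J\<^sub>c\<close> evaluated at \<open>A z\<close>
  instead of \<open>z\<close>, and the remainder is controlled by \<open>L\<^sub>c\<close> and the displacement \<open>\<parallel>z - A z\<parallel>\<close>. The last two
  entries of the minimum defining \<open>\<epsilon>\<close> make these two parts at most \<open>\<sigma> / 32\<close> each.\<close>

lemma norm_JA_Jc_le:
  assumes z: "z \<in> Omega_bar c A x" and p: "p \<in> feasible c" "dist z p \<le> dist x z"
  shows "norm (matop (tjac A z ** tjac c z)) \<le> \<sigma> / 16"
proof -
  define d where "d = dist x z"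
  note \<Omega> = Omega_bar_dist[OF z, folded d_def]
  have Th: "z \<in> \<Theta>" "p \<in> \<Theta>"
    using \<Omega>(3) rho_pos dist_triangle[of x p z] p(2) by (auto simp: Theta_def d_def)
  have MAd: "MA * d \<le> \<epsilon>"
  proof -
    have "\<sigma> * MA \<le> Mc * (MA + 1)"
      using sigma_pos sigma_le_Mc MA_nonneg by (intro mult_mono) auto
    also have "\<dots> \<le> 4 * Mc * (MA + 1) + \<sigma>"
      using sigma_pos sigma_le_Mc MA_nonneg mult_nonneg_nonneg[of Mc "MA + 1"] by simp
    finally have "\<sigma> * (MA * d) \<le> d * (4 * Mc * (MA + 1) + \<sigma>)"
      using mult_left_mono[of "\<sigma> * MA" "4 * Mc * (MA + 1) + \<sigma>" d] by (simp add: d_def mult_ac)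
    also have "\<dots> \<le> \<sigma> * \<epsilon>" by (rule \<Omega>(1))
    finally show ?thesis using sigma_pos by simp
  qed
  have "dist x (A z) \<le> MA * d"
    using A_lipschitz[OF x_in_Theta Th(1)] A_fixes[OF x_feasible] by (simp add: dist_norm d_def)
  also have "MA * d \<le> \<rho>" using MAd eps_le_rho rho_pos by simp
  finally have Az: "A z \<in> \<Theta>" by (simp add: Theta_def)
  have "norm (A z - z) \<le> norm (A z - A p) + norm (p - z)"
    using norm_triangle_ineq[of "A z - A p" "p - z"] A_fixes[OF p(1)] by simp
  also have "\<dots> \<le> (MA + 1) * dist z p"
    using A_lipschitz[OF Th] by (simp add: dist_norm norm_minus_commute algebra_simps)
  also have "\<dots> \<le> (MA + 1) * d"
    using p(2) MA_nonneg by (intro mult_left_mono) (auto simp: d_def)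
  finally have move: "norm (z - A z) \<le> (MA + 1) * d" by (simp add: norm_minus_commute)
  have "tjac A z ** tjac c z = tjac A z ** tjac c (A z) + tjac A z ** (tjac c z - tjac c (A z))"
    by (simp add: matrix_add_ldistrib[symmetric])
  then have "matop (tjac A z ** tjac c z)
      = matop (tjac A z ** tjac c (A z)) + (matop (tjac A z) o\<^sub>L matop (tjac c z - tjac c (A z)))"
    by (intro blinfun_eqI) (simp add: blinfun.add_left matrix_vector_mult_add_rdistrib matrix_vector_mul_assoc)
  then have "norm (matop (tjac A z ** tjac c z))
      \<le> norm (matop (tjac A z ** tjac c (A z))) + norm (matop (tjac A z)) * norm (matop (tjac c z - tjac c (A z)))"
    by (simp only:) (intro order_trans[OF norm_triangle_ineq] add_left_mono norm_blinfun_compose)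
  also have "\<dots> \<le> Lb * d + MA * (Lc * ((MA + 1) * d))"
  proof (intro add_mono mult_mono)
    show "norm (matop (tjac A z ** tjac c (A z))) \<le> Lb * d"
      using JA_Jc_bound[OF Th p(1)] mult_left_mono[OF p(2) Lb_nonneg] by (simp add: dist_norm d_def)
    show "norm (matop (tjac c z - tjac c (A z))) \<le> Lc * ((MA + 1) * d)"
      using Jc_bound[OF Th(1) Az] mult_left_mono[OF move Lc_nonneg] by linarith
  qed (use norm_JA_le[OF Th(1)] MA_nonneg in auto)
  also have "\<dots> \<le> \<sigma> / 32 + \<sigma> / 32"
  proof (rule add_mono)
    have "5 * \<sigma> * (8 * Lb * d) \<le> 5 * (8 * Lb * Mc * d)"
      using mult_right_mono[OF sigma_le_Mc, of "40 * Lb * d"] Lb_nonneg by (simp add: mult_ac d_def)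
    also have "\<dots> \<le> 8 * Lb * Mc * \<epsilon>"
      using \<Omega>(2) mult_left_mono[OF \<Omega>(2), of "8 * Lb * Mc"] Lb_nonneg sigma_pos sigma_le_Mc by (simp add: mult_ac)
    also have "\<dots> \<le> \<sigma> * \<sigma>" using eps_Lb by (simp add: power2_eq_square)
    finally have "\<sigma> * (40 * (Lb * d)) \<le> \<sigma> * \<sigma>" by simp
    then have "40 * (Lb * d) \<le> \<sigma>" using sigma_pos by simp
    moreover have "0 \<le> Lb * d" using Lb_nonneg by (simp add: d_def)
    ultimately show "Lb * d \<le> \<sigma> / 32" by simp
    have "MA * (Lc * ((MA + 1) * d)) = (Lc * (MA + 1)) * (MA * d)" by simp
    also have "\<dots> \<le> (Lc * (MA + 1)) * \<epsilon>"
      using MAd Lc_nonneg MA_nonneg by (intro mult_left_mono) auto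
    also have "\<dots> \<le> \<sigma> / 32" using eps_Lc by simp
    finally show "MA * (Lc * ((MA + 1) * d)) \<le> \<sigma> / 32" .
  qed
  finally show ?thesis by simp
qed

text \<open>With \<open>P\<close> the idempotent \<open>J\<^sub>A\<close> at \<open>p\<close>, the defect \<open>J - J\<^sup>2\<close> equals
  \<open>(J - P) - (J (J - P) + (J - P) P)\<close>, so it is of the order of \<open>J - P\<close>.\<close>

lemma JA_almost_idempotent:
  assumes z: "z \<in> \<Theta>" and p: "p \<in> feasible c" "dist x p < \<rho>"
  shows "norm (matop (tjac A z - tjac A z ** tjac A z)) \<le> (2 * MA + 1) * LA * dist z p"
proof -
  have "p \<in> \<Theta>" using p(2) by (simp add: Theta_def)
  let ?J = "matop (tjac A z)" and ?P = "matop (tjac A p)"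
  have eq: "matop (tjac A z - tjac A z ** tjac A z) = (?J - ?P) - ((?J o\<^sub>L (?J - ?P)) + ((?J - ?P) o\<^sub>L ?P))"
  proof (rule blinfun_eqI)
    fix h
    have "tjac A p *v (tjac A p *v h) = tjac A p *v h"
      using JA_idempotent[OF p] by (simp add: matrix_vector_mul_assoc)
    then show "blinfun_apply (matop (tjac A z - tjac A z ** tjac A z)) h
        = blinfun_apply ((?J - ?P) - ((?J o\<^sub>L (?J - ?P)) + ((?J - ?P) o\<^sub>L ?P))) h"
      by (simp add: blinfun.diff_left blinfun.add_left blinfun.diff_right matrix_vector_mult_diff_rdistrib
          matrix_vector_mult_diff_distrib matrix_vector_mul_assoc[symmetric])
  qed
  have d: "norm (?J - ?P) \<le> LA * dist z p"
    using JA_bound[OF z \<open>p \<in> \<Theta>\<close>] by (simp add: matop_diff dist_norm)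
  have "norm (matop (tjac A z - tjac A z ** tjac A z))
      \<le> norm (?J - ?P) + (norm ?J * norm (?J - ?P) + norm (?J - ?P) * norm ?P)"
    unfolding eq by (intro order_trans[OF norm_triangle_ineq4] add_mono order_refl
        order_trans[OF norm_triangle_ineq] norm_blinfun_compose)
  also have "\<dots> \<le> LA * dist z p + (MA * (LA * dist z p) + LA * dist z p * MA)"
    using d norm_JA_le[OF z] norm_JA_le[OF \<open>p \<in> \<Theta>\<close>] MA_nonneg LA_nonneg
    by (intro add_mono mult_mono) auto
  finally show ?thesis by (simp add: algebra_simps)
qed

text \<open>Stationarity puts \<open>- \<beta> J\<^sub>c c\<close> into the range of \<open>J = J\<^sub>A\<close>, and \<open>I - J\<close> nearly annihilates this range
  while it hardly shrinks \<open>J\<^sub>c c\<close>, since \<open>J J\<^sub>c\<close> is small. So \<open>\<beta> \<sigma> \<parallel>c z\<parallel>\<close> is at most a constant times the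
  distance to the feasible set, which is itself at most \<open>3 \<parallel>c z\<parallel> / \<sigma>\<close>. For large \<open>\<beta>\<close> this leaves only
  \<open>c z = 0\<close>.\<close>

lemma stationary_imp_feasible:
  assumes z: "z \<in> Omega_bar c A x" and "\<beta> > 0"
    and \<beta>: "16 * Mf * LA * (2 * MA + 1) \<le> \<beta> * \<sigma>\<^sup>2"
    and stat: "tjac A z *v grad f (A z) = - \<beta> *\<^sub>R (tjac c z *v c z)"
  shows "c z = 0"
proof (rule ccontr)
  assume "c z \<noteq> 0"
  obtain p where p: "p \<in> feasible c" "\<sigma> / 3 * dist z p \<le> norm (c z)" "dist z p \<le> dist x z"
    by (rule feasible_near_Omega_bar[OF z])
  have "z \<in> \<Theta>" "dist x p < \<rho>"
    using Omega_bar_dist(3)[OF z] rho_pos dist_triangle[of x p z] p(3) by (auto simp: Theta_def)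
  let ?J = "tjac A z" and ?g = "grad f (A z)" and ?w = "tjac c z *v c z"
  \<comment> \<open>Since \<open>\<parallel>J\<^sub>c c\<parallel> \<ge> \<sigma> / 2 \<parallel>c\<parallel>\<close>, the loss of \<open>\<sigma> / 16\<close> leaves the factor \<open>7 / 16\<close>.\<close>
  have "norm (?w - ?J *v ?w) \<ge> norm ?w - norm ((?J ** tjac c z) *v c z)"
    by (simp add: matrix_vector_mul_assoc norm_triangle_ineq2)
  moreover have "norm ((?J ** tjac c z) *v c z) \<le> \<sigma> / 16 * norm (c z)"
    using order_trans[OF norm_mult_le mult_right_mono[OF norm_JA_Jc_le[OF z p(1,3)] norm_ge_zero]] .
  ultimately have "7 / 16 * \<sigma> * norm (c z) \<le> norm (?w - ?J *v ?w)"
    using Jc_expands[OF \<open>z \<in> \<Theta>\<close>, of "c z"] by simp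
  then have "\<beta> * (7 / 16 * \<sigma> * norm (c z)) \<le> \<beta> * norm (?w - ?J *v ?w)"
    using \<open>\<beta> > 0\<close> by simp
  also have "\<dots> = norm ((?J - ?J ** ?J) *v ?g)"
  proof -
    have "(?J - ?J ** ?J) *v ?g = - \<beta> *\<^sub>R (?w - ?J *v ?w)"
      unfolding matrix_vector_mult_diff_rdistrib matrix_vector_mul_assoc[symmetric] stat
        matrix_vector_mult_scaleR scaleR_diff_right ..
    then show ?thesis using \<open>\<beta> > 0\<close> by simp
  qed
  also have "\<dots> \<le> (2 * MA + 1) * LA * dist z p * Mf"
    using JA_almost_idempotent[OF \<open>z \<in> \<Theta>\<close> p(1) \<open>dist x p < \<rho>\<close>] norm_grad_le[OF \<open>z \<in> \<Theta>\<close>] Mf_nonneg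
    by (intro order_trans[OF norm_mult_le] mult_mono) (auto intro: order_trans[OF norm_ge_zero])
  finally have "\<beta> * (7 / 16 * \<sigma> * norm (c z)) * \<sigma> \<le> (2 * MA + 1) * LA * dist z p * Mf * \<sigma>"
    using less_imp_le[OF sigma_pos] by (rule mult_right_mono)
  also have "\<dots> = 3 * (Mf * LA * (2 * MA + 1)) * (\<sigma> / 3 * dist z p)" by simp
  also have "\<dots> \<le> 3 * (Mf * LA * (2 * MA + 1)) * norm (c z)"
    using p(2) Mf_nonneg LA_nonneg MA_nonneg by (intro mult_left_mono) auto
  also have "\<dots> \<le> 3 * (\<beta> * \<sigma>\<^sup>2 / 16) * norm (c z)"
    using \<beta> by (intro mult_right_mono mult_left_mono) (auto simp: mult_ac)
  finally have "7 / 16 * (\<beta> * \<sigma>\<^sup>2 * norm (c z)) \<le> 3 / 16 * (\<beta> * \<sigma>\<^sup>2 * norm (c z))"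
    by (simp add: power2_eq_square mult_ac)
  moreover have "\<beta> * \<sigma>\<^sup>2 * norm (c z) > 0"
    using \<open>\<beta> > 0\<close> sigma_pos \<open>c z \<noteq> 0\<close> by simp
  ultimately show False by linarith
qed

section \<open>Constrained minimisers minimise the penalty function\<close>

text \<open>The map \<open>A\<close> squares the infeasibility: the derivative of \<open>c \<circ> A\<close> is the transpose of
  \<open>J\<^sub>A J\<^sub>c(A \<cdot>)\<close>, which vanishes at \<open>p\<close> and grows at most linearly along the segment.\<close>

lemma norm_c_A_le:
  assumes "p \<in> feasible c" and seg: "closed_segment p y \<subseteq> \<Theta>"
  shows "norm (c (A y)) \<le> Lb * (dist y p)\<^sup>2"
proof -
  have ends: "p \<in> closed_segment p y" "y \<in> closed_segment p y" by simp_all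
  have "norm (c (A y) - c (A p)) \<le> Lb * dist y p * norm (y - p)"
  proof (rule mean_value_bound[OF convex_closed_segment, where F = "\<lambda>u. c (A u)"])
    show "((\<lambda>u. c (A u)) has_derivative (\<lambda>h. transpose (tjac c (A u)) *v (transpose (tjac A u) *v h))) (at u)" for u
      by (rule has_derivative_compose[OF has_derivative_tjac[OF A_diff] has_derivative_tjac[OF c_diff]])
    show "norm (transpose (tjac c (A u)) *v (transpose (tjac A u) *v h)) \<le> Lb * dist y p * norm h"
      if u: "u \<in> closed_segment p y" for u h
    proof -
      have "norm (transpose (tjac c (A u)) *v (transpose (tjac A u) *v h))
          = norm (transpose (tjac A u ** tjac c (A u)) *v h)"
        by (simp only: matrix_transpose_mul matrix_vector_mul_assoc)
      also have "\<dots> \<le> norm (matop (tjac A u ** tjac c (A u))) * norm h"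
        by (rule norm_transpose_mult_le)
      also have "\<dots> \<le> Lb * norm (u - p) * norm h"
        using JA_Jc_bound[of u p] u seg ends assms(1) by (intro mult_right_mono) auto
      also have "\<dots> \<le> Lb * dist y p * norm h"
        using segment_bound1[OF u] Lb_nonneg
        by (intro mult_right_mono mult_left_mono) (auto simp: dist_norm norm_minus_commute)
      finally show ?thesis .
    qed
  qed (use Lb_nonneg ends in auto)
  then show ?thesis
    using assms(1) A_fixes[OF assms(1)] by (simp add: feasible_def dist_norm power2_eq_square)
qed

text \<open>For \<open>y\<close> near \<open>z\<close>, let \<open>w\<close> be a feasible point close to \<open>A y\<close>. Then \<open>f (A y)\<close> falls below \<open>f w \<ge> f z\<close> by at
  most the gradient bound times \<open>\<parallel>A y - w\<parallel>\<close>. The error bound, used once at \<open>A y\<close> and once (squared,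
  by \<open>norm_c_A_le\<close>) at \<open>y\<close>, gives \<open>\<parallel>A y - w\<parallel> \<le> 27 L\<^sub>b \<parallel>c y\<parallel>\<^sup>2 / \<sigma>\<^sup>3\<close>, and the penalty term pays for this.\<close>

lemma feasible_minimizer_imp_cdf_minimizer:
  assumes z: "z \<in> feasible c" "dist x z < \<rho>" and "\<beta> > 0"
    and \<beta>: "64 * Mf * Lb \<le> \<beta> * \<sigma> ^ 3"
    and min: "local_minimizer_on (feasible c) f z"
  shows "local_minimizer_on UNIV (cdf f c A \<beta>) z"
proof -
  have "c z = 0" "A z = z" using z A_fixes by (auto simp: feasible_def)
  have "z \<in> \<Theta>" using z by (simp add: Theta_def)
  \<comment> \<open>The constant \<open>M\<^sub>f\<close> bounds the gradient at \<open>z\<close>, but near \<open>z\<close> only up to an excess \<open>\<eta>\<close>. The threshold on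
      \<open>\<beta>\<close> uses up \<open>27 / 32\<close> of the penalty term, and this \<open>\<eta>\<close> uses up less than \<open>1 / 8\<close> of it.\<close>
  define \<eta> where "\<eta> = \<beta> * \<sigma> ^ 3 / (432 * (Lb + 1))"
  have "\<eta> > 0" using \<open>\<beta> > 0\<close> sigma_pos Lb_nonneg by (simp add: \<eta>_def)
  have const: "54 * ((Mf + \<eta>) * Lb) \<le> \<beta> * \<sigma> ^ 3"
  proof -
    have "\<eta> * Lb \<le> \<eta> * (Lb + 1)" using \<open>\<eta> > 0\<close> by simp
    also have "\<dots> = \<beta> * \<sigma> ^ 3 / 432" using Lb_nonneg unfolding \<eta>_def by (simp add: divide_simps)
    finally have "54 * (\<eta> * Lb) \<le> \<beta> * \<sigma> ^ 3 / 8" by simp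
    moreover have "54 * (Mf * Lb) \<le> 54 / 64 * (\<beta> * \<sigma> ^ 3)" using \<beta> by (simp add: mult_ac)
    moreover have "0 \<le> \<beta> * \<sigma> ^ 3" using \<open>\<beta> > 0\<close> sigma_pos by simp
    ultimately show ?thesis unfolding distrib_right distrib_left by linarith
  qed
  obtain \<delta> where "\<delta> > 0" and \<delta>: "\<And>w. w \<in> feasible c \<Longrightarrow> dist w z < \<delta> \<Longrightarrow> f z \<le> f w"
    using min unfolding local_minimizer_on_def by blast
  obtain \<delta>' where "\<delta>' > 0" and \<delta>': "\<And>u. dist u z < \<delta>' \<Longrightarrow> dist (grad f u) (grad f z) < \<eta>"
    using continuous_grad[of UNIV] \<open>\<eta> > 0\<close> unfolding continuous_on_iff by (metis UNIV_I)
  have grad: "norm (grad f u) \<le> Mf + \<eta>" if "dist u z < \<delta>'" for u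
    using \<delta>'[OF that] norm_grad_le[OF \<open>z \<in> \<Theta>\<close>] norm_triangle_sub[of "grad f u" "grad f z"] \<open>A z = z\<close>
    by (simp add: dist_norm)
  define r where "r = min (min \<delta> \<delta>') (\<rho> - dist x z)"
  have "r > 0" using \<open>\<delta> > 0\<close> \<open>\<delta>' > 0\<close> z by (simp add: r_def)
  have sub: "ball z r \<subseteq> \<Theta>" using ball_subset_Theta[of z] by (auto simp: r_def)
  have f_bound: "norm (f u - f v) \<le> (Mf + \<eta>) * norm (u - v)" if "u \<in> ball z r" "v \<in> ball z r" for u v
  proof (rule mean_value_bound[OF convex_ball _ _ _ that])
    show "(f has_derivative (\<lambda>h. h \<bullet> grad f u)) (at u)" for u
      using GDERIV_grad[OF f_diff] by (simp add: gderiv_def)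
    show "norm (h \<bullet> grad f u) \<le> (Mf + \<eta>) * norm h" if "u \<in> ball z r" for u h
      using grad[of u] that Cauchy_Schwarz_ineq2[of h "grad f u"] mult_right_mono[of "norm (grad f u)" "Mf + \<eta>" "norm h"]
      by (simp add: r_def dist_commute mult.commute)
  qed (use Mf_nonneg \<open>\<eta> > 0\<close> in simp)
  have "\<forall>\<^sub>F y in nhds z. dist z y + norm (c y) / (\<sigma> / 3) < r"
    using eventually_small_constraint[of "\<lambda>y. y" z r] \<open>c z = 0\<close> \<open>r > 0\<close> by simp
  moreover have "\<forall>\<^sub>F y in nhds z. dist z (A y) + norm (c (A y)) / (\<sigma> / 3) < r"
    using eventually_small_constraint[OF continuous_A \<open>A z = z\<close> \<open>c z = 0\<close> \<open>r > 0\<close>] .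
  ultimately have "\<forall>\<^sub>F y in nhds z. cdf f c A \<beta> z \<le> cdf f c A \<beta> y"
  proof eventually_elim
    case (elim y)
    obtain p where p: "p \<in> feasible c" "p \<in> ball z r" "\<sigma> / 3 * dist y p \<le> norm (c y)"
      by (rule feasible_near[OF sub elim(1)])
    obtain w where w: "w \<in> feasible c" "w \<in> ball z r" "\<sigma> / 3 * dist (A y) w \<le> norm (c (A y))"
      by (rule feasible_near[OF sub elim(2)])
    have nonneg: "0 \<le> norm u / (\<sigma> / 3)" for u :: "real^'p" using sigma_pos by simp
    have "y \<in> ball z r" "A y \<in> ball z r"
      using elim nonneg[of "c y"] nonneg[of "c (A y)"] by auto
    then have "closed_segment p y \<subseteq> \<Theta>"
      using p(2) sub closed_segment_subset[of p "ball z r" y] by auto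
    then have "norm (c (A y)) \<le> Lb * (dist y p)\<^sup>2" by (rule norm_c_A_le[OF p(1)])
    then have w': "\<sigma> / 3 * dist (A y) w \<le> Lb * (dist y p)\<^sup>2" using w(3) by simp
    have "\<sigma> ^ 3 * ((Mf + \<eta>) * dist (A y) w) = (3 * \<sigma>\<^sup>2 * (Mf + \<eta>)) * (\<sigma> / 3 * dist (A y) w)"
      by (simp add: power2_eq_square power3_eq_cube)
    also have "\<dots> \<le> (3 * \<sigma>\<^sup>2 * (Mf + \<eta>)) * (Lb * (dist y p)\<^sup>2)"
      using w' Mf_nonneg \<open>\<eta> > 0\<close> by (intro mult_left_mono) auto
    also have "\<dots> = (27 * ((Mf + \<eta>) * Lb)) * (\<sigma> / 3 * dist y p)\<^sup>2"
      by (simp add: power2_eq_square)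
    also have "\<dots> \<le> (27 * ((Mf + \<eta>) * Lb)) * (norm (c y))\<^sup>2"
      using p(3) sigma_pos Mf_nonneg Lb_nonneg \<open>\<eta> > 0\<close> by (intro mult_left_mono power_mono) auto
    also have "\<dots> \<le> (\<beta> * \<sigma> ^ 3 / 2) * (norm (c y))\<^sup>2"
      using const by (intro mult_right_mono) auto
    also have "\<dots> = \<sigma> ^ 3 * (\<beta> / 2 * (norm (c y))\<^sup>2)" by simp
    finally have "(Mf + \<eta>) * dist (A y) w \<le> \<beta> / 2 * (norm (c y))\<^sup>2"
      using sigma_pos by simp
    moreover have "f w - f (A y) \<le> (Mf + \<eta>) * dist (A y) w"
      using f_bound[OF \<open>w \<in> ball z r\<close> \<open>A y \<in> ball z r\<close>] by (simp add: dist_norm norm_minus_commute)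
    moreover have "f z \<le> f w"
      using \<delta>[OF w(1)] w(2) by (simp add: r_def dist_commute)
    ultimately show ?case
      using \<open>c z = 0\<close> \<open>A z = z\<close> by (simp add: cdf_def)
  qed
  then show ?thesis
    unfolding local_minimizer_on_def eventually_nhds_metric by auto
qed

lemma cdf_minimizer_imp_feasible_minimizer:
  assumes "local_minimizer_on UNIV (cdf f c A \<beta>) z" "c z = 0"
  shows "local_minimizer_on (feasible c) f z"
proof -
  have eq: "cdf f c A \<beta> y = f y" if "y \<in> feasible c" for y
    using that A_fixes[OF that] by (simp add: cdf_def feasible_def)
  have z: "z \<in> feasible c" using assms(2) by (simp add: feasible_def)
  obtain \<delta> where "\<delta> > 0" and \<delta>: "\<And>y. dist y z < \<delta> \<Longrightarrow> cdf f c A \<beta> z \<le> cdf f c A \<beta> y"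
    using assms(1) unfolding local_minimizer_on_def by blast
  have "f z \<le> f y" if "y \<in> feasible c" "dist y z < \<delta>" for y
    using \<delta>[OF that(2)] eq[OF z] eq[OF that(1)] by simp
  with z \<open>\<delta> > 0\<close> show ?thesis unfolding local_minimizer_on_def by blast
qed

lemma beta_threshold_bounds:
  assumes "\<beta> \<ge> beta_threshold f c A x"
  shows "64 * Mf * Lb \<le> \<beta> * \<sigma> ^ 3" and "16 * Mf * LA * (2 * MA + 1) \<le> \<beta> * \<sigma>\<^sup>2"
proof -
  have "64 * Mf * (MA + 1) * Lb / \<sigma> ^ 3 \<le> \<beta>"
    using assms by (simp add: beta_threshold_def)
  then have "64 * Mf * (MA + 1) * Lb \<le> \<beta> * \<sigma> ^ 3"
    using sigma_pos by (simp add: pos_divide_le_eq)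
  moreover have "0 \<le> 64 * Mf * Lb * MA" using Mf_nonneg MA_nonneg Lb_nonneg by simp
  ultimately show "64 * Mf * Lb \<le> \<beta> * \<sigma> ^ 3" by (simp add: algebra_simps)
  have "16 * Mf * LA * (2 * MA + 1) / \<sigma>\<^sup>2 \<le> \<beta>"
    using assms by (simp add: beta_threshold_def)
  then show "16 * Mf * LA * (2 * MA + 1) \<le> \<beta> * \<sigma>\<^sup>2"
    using sigma_pos by (simp add: pos_divide_le_eq)
qed

end

section \<open>Local equivalence of the two problems\<close>

theorem theorem3p18:
  fixes f :: "real^'n \<Rightarrow> real"
    and c :: "real^'n \<Rightarrow> real^'p"
    and A :: "real^'n \<Rightarrow> real^'n"
    and x :: "real^'n"
    and \<beta> :: real
  assumes "\<forall>y. f differentiable (at y)"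
    and "\<forall>y. c differentiable (at y)"
    and "locally_lipschitz (grad f)"
    and "locally_lipschitz (\<lambda>y. matop (tjac c y))"
    and "\<forall>y\<in>feasible c. rank (tjac c y) = CARD('p)"
    and "\<forall>y. A differentiable (at y)"
    and "locally_lipschitz (\<lambda>y. matop (tjac A y))"
    and "\<forall>y\<in>feasible c. A y = y"
    and "\<forall>y\<in>feasible c. tjac A y ** tjac c y = 0"
    and "\<beta> > 0"
    and "x \<in> feasible c"
    and "\<beta> \<ge> beta_threshold f c A x"
  shows "(\<forall>z\<in>Omega_bar c A x. local_minimizer_on (feasible c) f z
            \<longrightarrow> local_minimizer_on UNIV (cdf f c A \<beta>) z)
       \<and> (\<forall>z\<in>Omega_bar c A x. local_minimizer_on UNIV (cdf f c A \<beta>) z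
            \<longrightarrow> local_minimizer_on (feasible c) f z)"
proof -
  interpret constraint_dissolving f c A x
    using assms(1-9,11) by unfold_locales simp_all
  note \<beta> = beta_threshold_bounds[OF \<open>\<beta> \<ge> beta_threshold f c A x\<close>]
  show ?thesis
  proof (intro conjI ballI impI)
    fix z assume z: "z \<in> Omega_bar c A x" and min: "local_minimizer_on (feasible c) f z"
    have "dist x z < \<rho>" using Omega_bar_dist(3)[OF z] rho_pos by simp
    moreover have "z \<in> feasible c" using min by (simp add: local_minimizer_on_def)
    ultimately show "local_minimizer_on UNIV (cdf f c A \<beta>) z"
      using \<open>\<beta> > 0\<close> \<beta>(1) min by (intro feasible_minimizer_imp_cdf_minimizer)
  next
    fix z assume z: "z \<in> Omega_bar c A x" and min: "local_minimizer_on UNIV (cdf f c A \<beta>) z"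
    show "local_minimizer_on (feasible c) f z"
      using stationary_imp_feasible[OF z \<open>\<beta> > 0\<close> \<beta>(2) cdf_stationary[OF min]]
      by (rule cdf_minimizer_imp_feasible_minimizer[OF min])
  qed
qed

end
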